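(* Identify $\mathbb{P}^4$ with the space of unordered $4$-tuples of points of $\mathbb{P}^1$, let $Q^3\subset\mathbb{P}^4$ be the smooth quadric given as the closure of the $\mathrm{PGL}(2,\mathbb{C})$-orbit of the point corresponding to $\{1,-1,i,-i\}$, and let $\mathcal{A}$ be the codimension one foliation of degree one on $Q^3$ induced by the action of the affine subgroup $\mathrm{Aff}(\mathbb{C})\subset\mathrm{PGL}(2,\mathbb{C})$. Then $\mathcal{A}$ does not extend, i.e. there is no codimension one holomorphic foliation on $\mathbb{P}^4$ whose restriction to $Q^3$ is $\mathcal{A}$.
   Context: Everything is over $\mathbb{C}$. A codimension one (singular holomorphic) foliation on a complex projective manifold $Y$ is determined by a line bundle $L$ and a section $\omega\in H^0(Y,\Omega^1_Y\otimes L)$ whose zero set has codimension at least $2$ and which is integrable: $\eta\wedge d\eta=0$ for any local representative $1$-form $\eta$ of $\omega$. Its singular set is the zero set of $\omega$. Sections differing by a nonzero constant determine the same foliation. For $Y=\mathbb{P}^4$ or a smooth hypersurface in $\mathbb{P}^4$, a codimension one foliation given by $\omega\in H^0(Y,\Omega^1_Y(k))$ has degree $k-2$. Let $j:Q^3\hookrightarrow\mathbb{P}^4$ be the inclusion. A foliation on $\mathbb{P}^4$ determined by $\omega\in H^0(\mathbb{P}^4,\Omega^1_{\mathbb{P}^4}(k))$ is transverse to $Q^3$ if the zero set of $j^*\omega$ has codimension at least two in $Q^3$; in that case $j^*\omega$ determines a foliation on $Q^3$, called its restriction to $Q^3$. A foliation on $Q^3$ extends if it is the restriction of some foliation on $\mathbb{P}^4$.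 Description of $\mathcal{A}$: $\mathbb{P}^4$ is realized as the space of classes, up to scalar, of homogeneous polynomials of degree four in two variables, i.e. four unordered points (with multiplicity) on the projective line, with the natural action of $\mathrm{Aut}(\mathbb{P}^1)\simeq\mathrm{PGL}(2,\mathbb{C})$. The orbit closure in the claim is described as a smooth quadric $Q^3\subset\mathbb{P}^4$. $\mathrm{Aff}(\mathbb{C})$ is the affine subgroup, i.e. the subgroup of $\mathrm{PGL}(2,\mathbb{C})$ fixing $\infty\in\mathbb{P}^1$, and its action on $Q^3$ induces the codimension one foliation $\mathcal{A}$ of degree one. The singular set of $\mathcal{A}$ has no isolated points: it is composed of a rational normal curve of degree four, a Veronese curve of degree three and a line, corresponding respectively to the points of the form $\{p,p,p,p\}$, $\{\infty,p,p,p\}$ and $\{p,\infty,\infty,\infty\}$.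
   Formalization: The orbit closure of {1,-1,i,-i} is a cubic hypersurface, not a smooth quadric; the result is stated instead for any unordered 4-tuple of points whose PGL(2,C)-orbit closure is a smooth quadric (such as {∞,1,w,w²} with w a primitive cube root of unity). *)

theory Defs
  imports "HOL-Analysis.Analysis" "HOL-Computational_Algebra.Fundamental_Theorem_Algebra"
begin

text \<open>
  Subvarieties \<open>Y\<close> of complex projective space are represented by their punctured affine cones
  \<open>M\<close>, subsets of \<open>complex^'n\<close> that avoid the origin and are stable under nonzero scalars.
  Passing to the cone preserves codimension, and the closure of a subset of projective space has as
  its cone the closure of the cone, with the origin removed.
\<close>

definition holomorphic_map_on :: "(complex^'m) set \<Rightarrow> (complex^'m \<Rightarrow> complex^'n) \<Rightarrow> bool" where
  "holomorphic_map_on U f \<longleftrightarrow>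
     (\<forall>x\<in>U. \<exists>f'. (f has_derivative f') (at x) \<and> (\<forall>c v. f' (c *s v) = c *s f' v))"

definition cdot :: "complex^'n \<Rightarrow> complex^'n \<Rightarrow> complex" where
  "cdot x y = (\<Sum>i\<in>UNIV. x $ i * y $ i)"

text \<open>
  \<open>contains_submanifold TYPE('d) Z\<close>: the set \<open>Z\<close> contains an immersed piece of complex manifold of
  dimension \<open>CARD('d)\<close>. For an analytic set \<open>Z\<close> this says that \<open>Z\<close> has dimension at least
  \<open>CARD('d)\<close>.
\<close>

definition contains_submanifold :: "'d::finite itself \<Rightarrow> (complex^'n) set \<Rightarrow> bool" where
  "contains_submanifold _ Z \<longleftrightarrow>
     (\<exists>(U :: (complex^'d) set) \<phi>. open U \<and> U \<noteq> {} \<and> holomorphic_map_on U \<phi> \<and>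
        (\<forall>u\<in>U. inj (frechet_derivative \<phi> (at u))) \<and> \<phi> ` U \<subseteq> Z)"


section \<open>Twisted one-forms and foliations\<close>

text \<open>
  Let \<open>M\<close> be the cone over \<open>Y\<close> and \<open>T x\<close> the tangent space of \<open>M\<close> at \<open>x\<close>. A one-form on \<open>M\<close> is a
  function \<open>\<omega>\<close> with \<open>\<omega> x v\<close> the value at \<open>x\<close> on the tangent vector \<open>v\<close>; only the values at
  \<open>x \<in> M\<close> and \<open>v \<in> T x\<close> are meaningful. It is holomorphic if near every point it is the restriction
  of a one-form \<open>\<Sum>i. A\<^sub>i dx\<^sub>i\<close> with holomorphic coefficients on an open set of the ambient space.
\<close>

definition local_representative ::
  "(complex^'n) set \<Rightarrow> (complex^'n \<Rightarrow> (complex^'n) set) \<Rightarrow> (complex^'n \<Rightarrow> complex^'n \<Rightarrow> complex) \<Rightarrow>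
   (complex^'n) set \<Rightarrow> (complex^'n \<Rightarrow> complex^'n) \<Rightarrow> bool" where
  "local_representative M T \<omega> U A \<longleftrightarrow>
     open U \<and> holomorphic_map_on U A \<and> (\<forall>x\<in>M \<inter> U. \<forall>v\<in>T x. \<omega> x v = cdot (A x) v)"

text \<open>
  Pulling back along \<open>M \<rightarrow> Y\<close> identifies \<open>H\<^sup>0(Y, \<Omega>\<^sup>1(k))\<close> with the holomorphic one-forms on \<open>M\<close> that
  are homogeneous of degree \<open>k\<close> (with respect to pullback by scalar multiplications) and are
  annihilated by the radial vector field.
\<close>

definition twisted_one_form ::
  "(complex^'n) set \<Rightarrow> (complex^'n \<Rightarrow> (complex^'n) set) \<Rightarrow> int \<Rightarrow>
   (complex^'n \<Rightarrow> complex^'n \<Rightarrow> complex) \<Rightarrow> bool" where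
  "twisted_one_form M T k \<omega> \<longleftrightarrow>
     (\<forall>x\<in>M. \<exists>U A. x \<in> U \<and> local_representative M T \<omega> U A) \<and>
     (\<forall>x\<in>M. \<forall>v\<in>T x. \<forall>c. c \<noteq> 0 \<longrightarrow> \<omega> (c *s x) (c *s v) = c powi k * \<omega> x v) \<and>
     (\<forall>x\<in>M. \<omega> x x = 0)"

definition zero_set ::
  "(complex^'n) set \<Rightarrow> (complex^'n \<Rightarrow> (complex^'n) set) \<Rightarrow> (complex^'n \<Rightarrow> complex^'n \<Rightarrow> complex) \<Rightarrow>
   (complex^'n) set" where
  "zero_set M T \<omega> = {x \<in> M. \<forall>v\<in>T x. \<omega> x v = 0}"

text \<open>The exterior derivative at \<open>x\<close> of the one-form \<open>\<Sum>i. A\<^sub>i dx\<^sub>i\<close>, evaluated on \<open>(u, v)\<close>.\<close>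

definition ext_deriv :: "(complex^'n \<Rightarrow> complex^'n) \<Rightarrow> complex^'n \<Rightarrow> complex^'n \<Rightarrow> complex^'n \<Rightarrow> complex"
  where "ext_deriv A x u v =
    cdot (frechet_derivative A (at x) u) v - cdot (frechet_derivative A (at x) v) u"

text \<open>
  Integrability \<open>\<eta> \<and> d\<eta> = 0\<close>, as an identity on the tangent spaces of \<open>M\<close>. The form on \<open>M\<close> is the
  pullback of a local representative on \<open>Y\<close> multiplied by a nowhere zero function, so the condition
  on \<open>M\<close> and the one on \<open>Y\<close> agree.
\<close>

definition integrable_one_form ::
  "(complex^'n) set \<Rightarrow> (complex^'n \<Rightarrow> (complex^'n) set) \<Rightarrow> (complex^'n \<Rightarrow> complex^'n \<Rightarrow> complex) \<Rightarrow>
   bool" where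
  "integrable_one_form M T \<omega> \<longleftrightarrow>
     (\<forall>U A. local_representative M T \<omega> U A \<longrightarrow>
        (\<forall>x\<in>M \<inter> U. \<forall>u\<in>T x. \<forall>v\<in>T x. \<forall>w\<in>T x.
           \<omega> x u * ext_deriv A x v w + \<omega> x v * ext_deriv A x w u + \<omega> x w * ext_deriv A x u v = 0))"

text \<open>
  The argument \<open>TYPE('d)\<close> records \<open>CARD('d) = dim Y\<close>. The cone \<open>M\<close> has dimension \<open>dim Y + 1\<close>, so a
  subset of \<open>M\<close> has codimension at least two iff its dimension is less than \<open>dim Y\<close>.
\<close>

definition codim_one_foliation ::
  "'d::finite itself \<Rightarrow> (complex^'n) set \<Rightarrow> (complex^'n \<Rightarrow> (complex^'n) set) \<Rightarrow> int \<Rightarrow>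
   (complex^'n \<Rightarrow> complex^'n \<Rightarrow> complex) \<Rightarrow> bool" where
  "codim_one_foliation d M T k \<omega> \<longleftrightarrow>
     twisted_one_form M T k \<omega> \<and> \<not> contains_submanifold d (zero_set M T \<omega>) \<and>
     integrable_one_form M T \<omega>"

definition same_foliation ::
  "(complex^'n) set \<Rightarrow> (complex^'n \<Rightarrow> (complex^'n) set) \<Rightarrow>
   (complex^'n \<Rightarrow> complex^'n \<Rightarrow> complex) \<Rightarrow> (complex^'n \<Rightarrow> complex^'n \<Rightarrow> complex) \<Rightarrow> bool" where
  "same_foliation M T \<omega> \<eta> \<longleftrightarrow> (\<exists>c. c \<noteq> 0 \<and> (\<forall>x\<in>M. \<forall>v\<in>T x. \<omega> x v = c * \<eta> x v))"


section \<open>Quadrics in projective four-space, restriction and extension\<close>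

definition quadric :: "complex^5^5 \<Rightarrow> (complex^5) set" where
  "quadric B = {x. x \<noteq> 0 \<and> cdot x (B *v x) = 0}"

definition quadric_tangent :: "complex^5^5 \<Rightarrow> complex^5 \<Rightarrow> (complex^5) set" where
  "quadric_tangent B x = {v. cdot v (B *v x) = 0}"

text \<open>For symmetric \<open>B\<close>, the gradient of the quadratic form at \<open>x\<close> is \<open>2 (B *v x)\<close>.\<close>

definition smooth_quadric :: "complex^5^5 \<Rightarrow> bool" where
  "smooth_quadric B \<longleftrightarrow> transpose B = B \<and> (\<forall>x\<in>quadric B. B *v x \<noteq> 0)"

definition foliation_on_P4 :: "int \<Rightarrow> (complex^5 \<Rightarrow> complex^5 \<Rightarrow> complex) \<Rightarrow> bool" where
  "foliation_on_P4 deg \<omega> \<longleftrightarrow> codim_one_foliation TYPE(4) (UNIV - {0}) (\<lambda>x. UNIV) (deg + 2) \<omega>"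

definition foliation_on_quadric ::
  "complex^5^5 \<Rightarrow> int \<Rightarrow> (complex^5 \<Rightarrow> complex^5 \<Rightarrow> complex) \<Rightarrow> bool" where
  "foliation_on_quadric B deg \<eta> \<longleftrightarrow>
     codim_one_foliation TYPE(3) (quadric B) (quadric_tangent B) (deg + 2) \<eta>"

text \<open>
  The pullback \<open>j\<^sup>*\<omega>\<close> to the quadric is the same function \<open>\<omega>\<close>, evaluated only on points of the cone
  over the quadric and on vectors tangent to it.
\<close>

definition transverse_to_quadric :: "complex^5^5 \<Rightarrow> (complex^5 \<Rightarrow> complex^5 \<Rightarrow> complex) \<Rightarrow> bool" where
  "transverse_to_quadric B \<omega> \<longleftrightarrow>
     \<not> contains_submanifold TYPE(3) (zero_set (quadric B) (quadric_tangent B) \<omega>)"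

definition extends_to_P4 :: "complex^5^5 \<Rightarrow> (complex^5 \<Rightarrow> complex^5 \<Rightarrow> complex) \<Rightarrow> bool" where
  "extends_to_P4 B \<eta> \<longleftrightarrow>
     (\<exists>deg \<omega>. foliation_on_P4 deg \<omega> \<and> transverse_to_quadric B \<omega> \<and>
        same_foliation (quadric B) (quadric_tangent B) \<omega> \<eta>)"


section \<open>Binary quartics and the action of the projective linear group\<close>

text \<open>
  The point \<open>[x : y]\<close> of the projective line is given by a nonzero vector \<open>z\<close> with \<open>z $ 1 = x\<close> and
  \<open>z $ 2 = y\<close>; its affine coordinate is \<open>x / y\<close>, and infinity is \<open>[1 : 0]\<close>. The coefficient of
  \<open>x^(4-i) y^i\<close> is \<open>a $ i\<close>; the indices are taken in the type \<open>5\<close> of integers modulo five.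
\<close>

definition quartic :: "complex^5 \<Rightarrow> complex^2 \<Rightarrow> complex" where
  "quartic a z = a $ 0 * (z $ 1)^4 + a $ 1 * (z $ 1)^3 * z $ 2 + a $ 2 * (z $ 1)^2 * (z $ 2)^2
     + a $ 3 * z $ 1 * (z $ 2)^3 + a $ 4 * (z $ 2)^4"

definition quartic_with_roots :: "(4 \<Rightarrow> complex^2) \<Rightarrow> complex^5" where
  "quartic_with_roots r = (THE a. \<forall>z. quartic a z = (\<Prod>j\<in>UNIV. r j $ 2 * z $ 1 - r j $ 1 * z $ 2))"

text \<open>
  The action of \<open>GL(2)\<close> that moves the roots of a quartic by \<open>g\<close>. It induces on projective space the
  action of \<open>PGL(2)\<close>. Since scalar matrices act by all nonzero scalars, the orbit of \<open>a\<close> under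
  \<open>GL(2)\<close> is the cone over the orbit of the corresponding point under \<open>PGL(2)\<close>.
\<close>

definition act :: "complex^2^2 \<Rightarrow> complex^5 \<Rightarrow> complex^5" where
  "act g a = (THE b. \<forall>z. quartic b z = quartic a (matrix_inv g *v z))"

definition orbit_closure :: "complex^5 \<Rightarrow> (complex^5) set" where
  "orbit_closure a = closure {act g a |g. invertible g} - {0}"

definition infinity_pt :: "complex^2" where
  "infinity_pt = axis 1 1"

text \<open>The preimage in \<open>GL(2)\<close> of the affine group.\<close>

definition affine_group :: "(complex^2^2) set" where
  "affine_group = {g. invertible g \<and> (\<exists>c. g *v infinity_pt = c *s infinity_pt)}"

text \<open>
  The tangent space at \<open>x\<close> of the orbit under the affine group, or rather of the cone over it; it
  contains the radial direction because \<open>affine_group\<close> contains the scalar matrices.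
\<close>

definition affine_orbit_tangent :: "complex^5 \<Rightarrow> (complex^5) set" where
  "affine_orbit_tangent x =
     {v. \<exists>\<gamma> :: real \<Rightarrow> complex^2^2. (\<forall>t. \<gamma> t \<in> affine_group) \<and> \<gamma> 0 = mat 1 \<and>
           \<gamma> differentiable at 0 \<and> ((\<lambda>t. act (\<gamma> t) x) has_vector_derivative v) (at 0)}"

text \<open>
  The foliation is tangent to all orbits of the affine group, and on a dense set of points the
  tangent space of the leaf is the tangent space of the orbit.
\<close>

definition induced_by_affine_group :: "complex^5^5 \<Rightarrow> (complex^5 \<Rightarrow> complex^5 \<Rightarrow> complex) \<Rightarrow> bool" where
  "induced_by_affine_group B \<eta> \<longleftrightarrow>
     (\<forall>x\<in>quadric B. \<forall>v\<in>affine_orbit_tangent x. \<eta> x v = 0) \<and>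
     quadric B \<subseteq>
       closure {x\<in>quadric B. {v\<in>quadric_tangent B x. \<eta> x v = 0} = affine_orbit_tangent x}"


section \<open>The base point of the orbit\<close>

text \<open>
  The four-tuples whose orbit closure is a smooth quadric are the equianharmonic ones, such as
  \<open>{\<infinity>, 1, w, w\<^sup>2}\<close> with \<open>w\<close> a primitive cube root of unity: the quadric is the zero locus of the
  invariant \<open>12 a\<^sub>0 a\<^sub>4 - 3 a\<^sub>1 a\<^sub>3 + a\<^sub>2\<^sup>2\<close> (lemmas \<open>orbit_closure_equianharmonic\<close> and
  \<open>smooth_BI\<close>). The tuple \<open>{1, -1, i, -i}\<close> is harmonic: the closure of its orbit is the cubic
  hypersurface where the invariant of degree three vanishes, and it is not a smooth quadric (lemma
  \<open>orbit_closure_harmonic\<close>). For this reason the base point of the orbit is kept variable, with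
  the assumption that the orbit closure is a smooth quadric.
\<close>

lemma exhaust_5: "(x::5) = 0 \<or> x = 1 \<or> x = 2 \<or> x = 3 \<or> x = 4"
proof (induct x)
  case (of_int z)
  hence "z = 0 \<or> z = 1 \<or> z = 2 \<or> z = 3 \<or> z = 4" by auto
  thus ?case by auto
qed

lemma forall_5: "(\<forall>i::5. P i) \<longleftrightarrow> P 0 \<and> P 1 \<and> P 2 \<and> P 3 \<and> P 4"
  by (metis exhaust_5)

lemma UNIV_5: "(UNIV::5 set) = {0, 1, 2, 3, 4}"
  using exhaust_5 by auto

lemma sum_5: "sum f (UNIV::5 set) = f 0 + f 1 + f 2 + f 3 + f 4"
  unfolding UNIV_5 by (simp add: ac_simps)

definition vec5 :: "'a \<Rightarrow> 'a \<Rightarrow> 'a \<Rightarrow> 'a \<Rightarrow> 'a \<Rightarrow> 'a^5" where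
  "vec5 a b c d e = (\<chi> i. if i = 0 then a else if i = 1 then b else if i = 2 then c
      else if i = 3 then d else e)"

lemma vec5_nth [simp]: "vec5 a b c d e $ 0 = a" "vec5 a b c d e $ 1 = b" "vec5 a b c d e $ 2 = c"
  "vec5 a b c d e $ 3 = d" "vec5 a b c d e $ 4 = e"
  by (simp_all add: vec5_def)

lemma vec5_eq: "x = vec5 (x$0) (x$1) (x$2) (x$3) (x$4)"
  by (simp add: vec_eq_iff forall_5)

lemma quartic_inj:
  assumes "\<forall>z. quartic a z = quartic b z" shows "a = b"
proof -
  have e: "quartic a (vector [x,y]) = quartic b (vector [x,y])" for x y using assms by blast
  note q = e[unfolded quartic_def vector_2]
  have 0: "a$0 = b$0" using q[of 1 0] by simp
  have 4: "a$4 = b$4" using q[of 0 1] by simp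
  have 1: "a$1 + a$2 + a$3 = b$1 + b$2 + b$3" using q[of 1 1] 0 4 by (simp add: algebra_simps)
  have 2: "- a$1 + a$2 - a$3 = - b$1 + b$2 - b$3" using q[of "1" "-1"] 0 4 by (simp add: algebra_simps)
  have 22: "a$2 = b$2" using arg_cong2[OF 1 2, of "(+)"] by (simp add: algebra_simps)
  have 3: "8 * a$1 + 4 * a$2 + 2* a$3 = 8 * b$1 + 4 * b$2 + 2* b$3" using q[of 2 1] 0 4 by (simp add: algebra_simps)
  have 5: "a$1 + a$3 = b$1 + b$3" using 1 22 by (simp add: algebra_simps)
  have "6 * a$1 + 2 * (a$1 + a$3) = 6 * b$1 + 2 * (b$1 + b$3)" using 3 22 by (simp add: algebra_simps)
  hence 11: "a$1 = b$1" using 5 by simp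
  hence 33: "a$3 = b$3" using 5 by simp
  show ?thesis using 0 11 22 33 4 by (simp add: vec_eq_iff forall_5)
qed

definition subst4 :: "complex^2^2 \<Rightarrow> complex^5 \<Rightarrow> complex^5" where
  "subst4 h a = (let p = h$1$1; q = h$1$2; r = h$2$1; t = h$2$2 in
     a$0 *s vec5 (p^4) (4*p^3*q) (6*p^2*q^2) (4*p*q^3) (q^4)
   + a$1 *s vec5 (p^3*r) (p^3*t+3*p^2*q*r) (3*p^2*q*t+3*p*q^2*r) (3*p*q^2*t+q^3*r) (q^3*t)
   + a$2 *s vec5 (p^2*r^2) (2*p^2*r*t+2*p*q*r^2) (p^2*t^2+4*p*q*r*t+q^2*r^2) (2*p*q*t^2+2*q^2*r*t) (q^2*t^2)
   + a$3 *s vec5 (p*r^3) (3*p*r^2*t+q*r^3) (3*p*r*t^2+3*q*r^2*t) (p*t^3+3*q*r*t^2) (q*t^3)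
   + a$4 *s vec5 (r^4) (4*r^3*t) (6*r^2*t^2) (4*r*t^3) (t^4))"

lemma quartic_subst4: "quartic (subst4 h a) z = quartic a (h *v z)"
  unfolding quartic_def subst4_def Let_def 
  by (simp add: matrix_vector_mult_def sum_2) algebra

lemma act_eq: "act g a = subst4 (matrix_inv g) a"
  unfolding act_def
  by (rule the_equality) (auto simp: quartic_subst4 intro: quartic_inj)

definition qI :: "complex^5 \<Rightarrow> complex" where
  "qI a = 12 * a$0 * a$4 - 3 * a$1 * a$3 + (a$2)^2"

lemma qI_subst4: "qI (subst4 h a) = (h$1$1*h$2$2 - h$1$2*h$2$1)^4 * qI a"
  unfolding qI_def subst4_def Let_def by simp algebra

definition orb where "orb a = {act g a |g. invertible g}"

lemma matrix_inv_invertible: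
  fixes h :: "complex^2^2"
  assumes "invertible h"
  shows "h ** matrix_inv h = mat 1" "matrix_inv h ** h = mat 1"
  using someI_ex[OF assms[unfolded invertible_def]] by (auto simp: matrix_inv_def)

lemma orb_eq: "orb a = {subst4 h a |h. invertible h}"
proof -
  have 1: "invertible (matrix_inv h)" if "invertible h" for h :: "complex^2^2"
    using matrix_inv_invertible[OF that] by (auto simp: invertible_def)
  have 2: "matrix_inv (matrix_inv h) = h" if "invertible h" for h :: "complex^2^2"
    using matrix_inv_invertible[OF that] matrix_inv_invertible[OF 1[OF that]]
    by (metis matrix_mul_assoc matrix_mul_lid matrix_mul_rid)
  show ?thesis unfolding orb_def act_eq by (auto, metis 1, metis 1 2)
qed

lemma subst4_subst4: "subst4 h (subst4 k a) = subst4 (k ** h) a"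
  by (rule quartic_inj) (simp add: quartic_subst4 matrix_vector_mul_assoc)

lemma continuous_subst4: "continuous_on S (subst4 h)"
  unfolding subst4_def Let_def vector_scalar_mult_def
  by (intro continuous_intros continuous_on_vec_lambda)

lemma closure_orb_subst4: 
  assumes "x \<in> closure (orb a)" "invertible h" shows "subst4 h x \<in> closure (orb a)"
proof -
  have "subst4 h ` closure (orb a) \<subseteq> closure (orb a)"
  proof (rule image_closure_subset)
    show "continuous_on (closure (orb a)) (subst4 h)" by (rule continuous_subst4)
    show "subst4 h ` orb a \<subseteq> closure (orb a)"
      using closure_subset[of "orb a"] assms(2) unfolding orb_eq
      by (auto simp: subst4_subst4 invertible_mult intro!: subsetD[OF closure_subset])
  qed auto
  thus ?thesis using assms by auto
qed


lemma exists_root: "\<exists>z::complex. z ^ Suc n = c"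
  by (rule exists_complex_root[of "Suc n" c]) auto

lemma limit_point:
  fixes f :: "complex \<Rightarrow> complex^5"
  assumes "continuous_on UNIV f" "\<And>t. t \<noteq> 0 \<Longrightarrow> f t \<in> closure C" shows "f 0 \<in> closure C"
proof -
  have "closure (- {0::complex}) = UNIV" by (simp add: closure_complement)
  moreover have "f ` closure (- {0}) \<subseteq> closure C"
    by (rule image_closure_subset) (use assms in \<open>auto intro: continuous_on_subset\<close>)
  ultimately show ?thesis by auto
qed

lemma continuous_vec5 [continuous_intros]:
  assumes "continuous_on S a" "continuous_on S b" "continuous_on S c" "continuous_on S d" "continuous_on S e"
  shows "continuous_on S (\<lambda>x. vec5 (a x) (b x) (c x) (d x) (e x) :: complex^5)"
  unfolding vec5_def
proof (rule continuous_on_vec_lambda)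
  fix i :: 5
  show "continuous_on S (\<lambda>x. if i = 0 then a x else if i = 1 then b x else if i = 2 then c x
      else if i = 3 then d x else e x)"
    using exhaust_5[of i] assms by auto
qed

definition mat2 :: "complex \<Rightarrow> complex \<Rightarrow> complex \<Rightarrow> complex \<Rightarrow> complex^2^2" where
  "mat2 p q r t = vector [vector [p, q], vector [r, t]]"

lemma mat2_nth [simp]: "mat2 p q r t $ 1 $ 1 = p" "mat2 p q r t $ 1 $ 2 = q"
   "mat2 p q r t $ 2 $ 1 = r" "mat2 p q r t $ 2 $ 2 = t"
  by (simp_all add: mat2_def)

lemma mat2_inv: "invertible (mat2 p q r t) \<longleftrightarrow> p * t \<noteq> q * r"
  by (simp add: invertible_det_nz det_2)

lemma subst4_id: "subst4 (mat 1) a = a"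
  by (rule quartic_inj) (simp add: quartic_subst4)

abbreviation "p0 \<equiv> vec5 0 (-1) 0 0 1 :: complex^5"

lemma cl1:
  assumes "a \<noteq> 0" "b \<noteq> 0" shows "vec5 0 a 0 0 b \<in> closure (orb p0)"
proof -
  obtain t where t: "t ^ 4 = b" using exists_root[of 3 b] by auto
  with assms have t0: "t \<noteq> 0" by auto
  obtain s where s: "s ^ 3 = - a / t" using exists_root[of 2 "-a/t"] by (auto simp: eval_nat_numeral)
  with assms t0 have s0: "s \<noteq> 0" by auto
  have "subst4 (mat2 s 0 0 t) p0 = vec5 0 a 0 0 b"
    using s t t0 by (simp add: subst4_def vec_eq_iff forall_5)
  moreover have "subst4 (mat2 s 0 0 t) p0 \<in> orb p0"
    unfolding orb_eq using s0 t0 by (auto simp: mat2_inv)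
  ultimately show ?thesis using closure_subset by fastforce
qed

lemma cl2:
  assumes "a \<noteq> 0" shows "vec5 0 a 0 0 b \<in> closure (orb p0)"
proof (cases "b = 0")
  case True
  have "(\<lambda>b. vec5 0 a 0 0 b) 0 \<in> closure (orb p0)"
    by (rule limit_point) (auto intro!: continuous_intros cl1 assms)
  thus ?thesis using True by simp
qed (use cl1 assms in auto)

lemma closure_orb_iff:
  assumes "invertible h" "subst4 h x \<in> closure (orb a)" shows "x \<in> closure (orb a)"
proof -
  obtain k where k: "h ** k = mat 1" "k ** h = mat 1" using assms(1) by (auto simp: invertible_def)
  hence "invertible k" by (auto simp: invertible_def)
  from closure_orb_subst4[OF assms(2) this] show ?thesis by (simp add: subst4_subst4 k subst4_id)
qed

lemma cl3:
  assumes "a$0 = 0" "a$1 \<noteq> 0" "qI a = 0" shows "a \<in> closure (orb p0)"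
proof -
  define c where "c = - a$2 / (3 * a$1)"
  let ?h = "mat2 1 c 0 1"
  let ?b = "subst4 ?h a"
  have i: "invertible ?h" by (simp add: mat2_inv)
  have 0: "?b$0 = 0" "?b$1 = a$1" using assms by (simp_all add: subst4_def)
  have 2: "?b$2 = 0" using assms by (simp add: subst4_def c_def)
  have "qI ?b = 0" using assms by (simp add: qI_subst4)
  hence 3: "?b$3 = 0" using 0 2 assms(2) by (simp add: qI_def)
  have "?b = vec5 0 (a$1) 0 0 (?b$4)" using 0 2 3 by (simp add: vec_eq_iff forall_5)
  hence "?b \<in> closure (orb p0)" using cl2[OF assms(2)] by metis
  thus ?thesis using closure_orb_iff i by blast
qed

lemma cl4:
  assumes "a$0 = 0" "qI a = 0" shows "a \<in> closure (orb p0)"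
proof (cases "a$1 = 0")
  case True
  with assms have 2: "a$2 = 0" by (simp add: qI_def)
  obtain s where s: "s ^ 2 = 3 * a$3" using exists_root[of 1] by (auto simp: eval_nat_numeral)
  have "(\<lambda>t. vec5 0 (t^2) (t * s) (a$3) (a$4)) 0 \<in> closure (orb p0)"
    by (rule limit_point)
       (auto intro!: continuous_intros cl3 simp: qI_def power_mult_distrib s)
  moreover have "vec5 0 (0^2) (0 * s) (a$3) (a$4) = a" using assms True 2 by (simp add: vec_eq_iff forall_5)
  ultimately show ?thesis by simp
qed (use cl3 assms in auto)

lemma cl5:
  assumes "qI a = 0" shows "a \<in> closure (orb p0)"
proof (cases "a$0 = 0")
  case False
  let ?p = "[:a$4, a$3, a$2, a$1, a$0:]"
  have "\<not> constant (poly ?p)"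
    by (subst constant_degree) (use False in simp)
  from fundamental_theorem_of_algebra[OF this] obtain z where z: "poly ?p z = 0" by blast
  let ?h = "mat2 z 1 1 0"
  have "(subst4 ?h a)$0 = poly ?p z" by (simp add: subst4_def) algebra
  with z have "(subst4 ?h a)$0 = 0" by simp
  moreover have "qI (subst4 ?h a) = 0" using assms by (simp add: qI_subst4)
  ultimately show ?thesis using cl4 closure_orb_iff[of ?h] by (auto simp: mat2_inv)
qed (use cl4 assms in auto)

lemma closed_qI: "closed {a. qI a = 0}"
  unfolding qI_def by (intro closed_Collect_eq continuous_intros)

lemma orbit_closure_p0: "orbit_closure p0 = {a. a \<noteq> 0 \<and> qI a = 0}"
proof -
  have "closure (orb p0) \<subseteq> {a. qI a = 0}"
    by (rule closure_minimal[OF _ closed_qI]) (auto simp: orb_eq qI_subst4, simp add: qI_def)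
  thus ?thesis unfolding orbit_closure_def orb_def[symmetric] using cl5 by auto
qed


definition affine_pt :: "complex \<Rightarrow> complex^2" where
  "affine_pt z = vector [z, 1]"

definition four_points :: "'a \<Rightarrow> 'a \<Rightarrow> 'a \<Rightarrow> 'a \<Rightarrow> 4 \<Rightarrow> 'a" where
  "four_points a b c d = (\<lambda>j. if j = 1 then a else if j = 2 then b else if j = 3 then c else d)"

lemma quartic_with_roots_eq:
  assumes "\<And>z. quartic a z = (\<Prod>j\<in>UNIV. r j $ 2 * z $ 1 - r j $ 1 * z $ 2)"
  shows "quartic_with_roots r = a"
  unfolding quartic_with_roots_def using assms by (intro the_equality) (auto intro: quartic_inj)

lemma prod_4: "prod f (UNIV::4 set) = f 1 * f 2 * f 3 * f 4"
  unfolding UNIV_4 by (simp add: ac_simps)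

lemma cube_roots:
  fixes x y w :: complex
  assumes "w^2 + w + 1 = 0"
  shows "y^4 - x^3 * y = - (y * ((x - y) * ((x - w * y) * (x - w^2 * y))))"
proof -
  have 1: "w + w^2 = -1" using assms by (simp add: algebra_simps eq_neg_iff_add_eq_0)
  have "w^3 - 1 = (w - 1) * (w^2 + w + 1)" by (simp add: algebra_simps power2_eq_square power3_eq_cube)
  hence 2: "w^3 = 1" using assms by simp
  have "(x - w * y) * (x - w^2 * y) = x^2 - (w + w^2) * (x * y) + w^3 * y^2"
    by (simp add: algebra_simps power2_eq_square power3_eq_cube)
  also have "\<dots> = x^2 + x * y + y^2" unfolding 1 2 by simp
  finally show ?thesis
    by (simp add: algebra_simps power2_eq_square power3_eq_cube power4_eq_xxxx)
qed

lemma fourth_roots: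
  fixes x y :: complex
  shows "x^4 - y^4 = (x - y) * (x + y) * (x - \<i> * y) * (x + \<i> * y)"
proof -
  have "(x - \<i> * y) * (x + \<i> * y) = x^2 + y^2"
    by (simp add: algebra_simps power2_eq_square)
  hence "(x - y) * (x + y) * (x - \<i> * y) * (x + \<i> * y) = (x - y) * (x + y) * (x^2 + y^2)"
    by (simp add: mult.assoc)
  thus ?thesis by (simp add: algebra_simps power2_eq_square power4_eq_xxxx)
qed

lemma roots_p0:
  assumes "w^2 + w + 1 = 0"
  shows "quartic_with_roots (four_points infinity_pt (affine_pt 1) (affine_pt w) (affine_pt (w^2))) = p0"
proof (rule quartic_with_roots_eq)
  fix z :: "complex^2"
  show "quartic p0 z = (\<Prod>j\<in>UNIV.
            four_points infinity_pt (affine_pt 1) (affine_pt w) (affine_pt (w^2)) j $ 2 * z $ 1 -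
            four_points infinity_pt (affine_pt 1) (affine_pt w) (affine_pt (w^2)) j $ 1 * z $ 2)"
    using cube_roots[OF assms, where x = "z$1" and y = "z$2"]
    by (simp add: prod_4 four_points_def infinity_pt_def affine_pt_def quartic_def axis_def mult.assoc)
qed

lemma roots_p1:
  "quartic_with_roots (four_points (affine_pt 1) (affine_pt (-1)) (affine_pt \<i>) (affine_pt (- \<i>)))
     = vec5 1 0 0 0 (-1)"
proof (rule quartic_with_roots_eq)
  fix z :: "complex^2"
  show "quartic (vec5 1 0 0 0 (-1)) z = (\<Prod>j\<in>UNIV.
            four_points (affine_pt 1) (affine_pt (-1)) (affine_pt \<i>) (affine_pt (- \<i>)) j $ 2 * z $ 1 -
            four_points (affine_pt 1) (affine_pt (-1)) (affine_pt \<i>) (affine_pt (- \<i>)) j $ 1 * z $ 2)"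
    using fourth_roots[where x = "z$1" and y = "z$2"]
    by (simp add: prod_4 four_points_def affine_pt_def quartic_def)
qed

definition BI :: "complex^5^5" where
  "BI = vec5 (vec5 0 0 0 0 6) (vec5 0 0 0 (-3/2) 0) (vec5 0 0 1 0 0) (vec5 0 (-3/2) 0 0 0)
     (vec5 6 0 0 0 0)"

lemma cdot_BI: "cdot a (BI *v a) = qI a"
  by (simp add: cdot_def matrix_vector_mult_def sum_5 BI_def qI_def power2_eq_square)

lemma smooth_BI: "smooth_quadric BI"
proof -
  have "transpose BI = BI" by (simp add: transpose_def vec_eq_iff forall_5 BI_def)
  moreover have "BI *v x \<noteq> 0" if "x \<noteq> 0" for x
    using that by (auto simp: matrix_vector_mult_def sum_5 vec_eq_iff forall_5 BI_def)
  ultimately show ?thesis by (auto simp: smooth_quadric_def quadric_def)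
qed

lemma orbit_closure_equianharmonic:
  assumes "w^2 + w + 1 = 0"
  shows "orbit_closure
      (quartic_with_roots (four_points infinity_pt (affine_pt 1) (affine_pt w) (affine_pt (w^2))))
    = quadric BI"
  unfolding roots_p0[OF assms] orbit_closure_p0 quadric_def cdot_BI by simp

lemma cdot_diff: "cdot (x - y) z = cdot x z - cdot y z" "cdot x (y - z) = cdot x y - cdot x z"
  by (simp_all only: cdot_def vector_minus_component left_diff_distrib right_diff_distrib sum_subtractf)

lemma cdot_scale: "cdot (c *s x) z = c * cdot x z" "cdot x (c *s z) = c * cdot x z"
  by (simp_all only: cdot_def vector_smult_component sum_distrib_left mult.assoc mult.left_commute)

lemma cdot_symm:
  fixes B :: "complex^5^5"
  assumes "transpose B = B"
  shows "cdot x (B *v y) = cdot y (B *v x)"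
proof -
  have s: "B $ i $ j = B $ j $ i" for i j
    using arg_cong[OF assms, of "\<lambda>B. B $ i $ j"] by (simp add: transpose_def)
  have "cdot x (B *v y) = (\<Sum>i\<in>UNIV. \<Sum>j\<in>UNIV. x$i * (B$i$j * y$j))"
    by (simp only: cdot_def matrix_vector_mult_def vec_lambda_beta sum_distrib_left)
  also have "\<dots> = (\<Sum>j\<in>UNIV. \<Sum>i\<in>UNIV. x$i * (B$i$j * y$j))" by (rule sum.swap)
  also have "\<dots> = (\<Sum>j\<in>UNIV. \<Sum>i\<in>UNIV. y$j * (B$j$i * x$i))"
    by (intro sum.cong refl) (subst s, simp only: mult_ac)
  also have "\<dots> = cdot y (B *v x)"
    by (simp only: cdot_def matrix_vector_mult_def vec_lambda_beta sum_distrib_left)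
  finally show ?thesis .
qed

definition nu :: "complex \<Rightarrow> complex \<Rightarrow> complex^5" where
  "nu p q = vec5 (p^4) (4*p^3*q) (6*p^2*q^2) (4*p*q^3) (q^4)"

lemma orbit_closure_harmonic:
  assumes "orbit_closure (quartic_with_roots
      (four_points (affine_pt 1) (affine_pt (-1)) (affine_pt \<i>) (affine_pt (- \<i>)))) = quadric B"
  shows "\<not> smooth_quadric B"
proof
  assume sm: "smooth_quadric B"
  hence sym: "transpose B = B" by (simp add: smooth_quadric_def)
  let ?p = "vec5 1 0 0 0 (-1) :: complex^5"
  define b where "b x y = cdot x (B *v y)" for x y
  note b = cdot_symm[OF sym, folded b_def]
  have bl: "b (x - y) z = b x z - b y z" "b x (y - z) = b x y - b x z"
    "b (c *s x) z = c * b x z" "b x (c *s z) = c * b x z" for x y z c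
    by (simp_all add: b_def cdot_diff cdot_scale matrix_vector_mult_diff_distrib vector_scalar_commute)
  have q: "b a a = 0" if "a \<in> orb ?p" for a
  proof (cases "a = 0")
    case True thus ?thesis by (simp add: b_def cdot_def)
  next
    case False
    hence "a \<in> orbit_closure ?p" using that closure_subset by (auto simp: orbit_closure_def orb_def[symmetric])
    thus ?thesis using assms unfolding roots_p1 by (auto simp: quadric_def b_def)
  qed
  have s: "subst4 (mat2 p q r t) ?p = nu p q - nu r t" for p q r t
    by (simp add: subst4_def nu_def vec_eq_iff forall_5)
  have h: "nu (c*p) (c*q) = c^4 *s nu p q" for c p q
    by (simp add: nu_def vec_eq_iff forall_5 power_mult_distrib) (simp add: eval_nat_numeral)
  have e: "(c^4)^2 * b (nu p q) (nu p q) - 2 * c^4 * b (nu p q) (nu r t) + b (nu r t) (nu r t) = 0"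
    if "p * t \<noteq> q * r" "c \<noteq> 0" for p q r t c
  proof -
    have "subst4 (mat2 (c*p) (c*q) r t) ?p \<in> orb ?p"
      unfolding orb_eq using that by (auto simp: mat2_inv)
    from q[OF this] show ?thesis
      unfolding s h bl b[of "nu r t" "nu p q"] by (simp add: power2_eq_square algebra_simps)
  qed
  have z: "b (nu p q) (nu p q) = 0" "b (nu p q) (nu r t) = 0" if "p * t \<noteq> q * r" for p q r t
  proof -
    note e = e[OF that]
    have e1: "b (nu p q) (nu p q) - 2 * b (nu p q) (nu r t) + b (nu r t) (nu r t) = 0" using e[of 1] by simp
    have e2: "256 * b (nu p q) (nu p q) - 32 * b (nu p q) (nu r t) + b (nu r t) (nu r t) = 0" using e[of 2] by simp
    have e3: "6561 * b (nu p q) (nu p q) - 162 * b (nu p q) (nu r t) + b (nu r t) (nu r t) = 0" using e[of 3] by simp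
    have 1: "30 * b (nu p q) (nu r t) = 255 * b (nu p q) (nu p q)" using e1 e2 by algebra
    have 2: "160 * b (nu p q) (nu r t) = 6560 * b (nu p q) (nu p q)" using e1 e3 by algebra
    have 3: "30 * (6560 * b (nu p q) (nu p q)) = 160 * (255 * b (nu p q) (nu p q))"
      unfolding 1[symmetric] 2[symmetric] by simp
    thus 4: "b (nu p q) (nu p q) = 0" by simp
    show "b (nu p q) (nu r t) = 0" using 1 4 by simp
  qed
  have B0: "B *v nu p q = 0" if pq: "(p = 1 \<and> q = 0) \<or> (p = 0 \<and> q = 1)" for p q
  proof -
    let ?w = "B *v nu p q"
    have v: "cdot (nu r t) ?w = 0" for r t
    proof (cases "p * t = q * r")
      case False thus ?thesis using z(2)[OF False] b[of "nu p q" "nu r t"] by (simp add: b_def)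
    next
      case True
      then obtain c where "nu r t = nu (c*p) (c*q)" using pq by auto
      moreover have "b (nu p q) (nu p q) = 0" using z(1)[of p q q p] z(1)[of p p q "-q"] pq by auto
      ultimately show ?thesis by (simp add: h bl b_def cdot_scale)
    qed
    have "vec5 (?w$0) (4 * ?w$1) (6 * ?w$2) (4 * ?w$3) (?w$4) = 0"
    proof (rule quartic_inj, rule allI)
      fix x show "quartic (vec5 (?w$0) (4 * ?w$1) (6 * ?w$2) (4 * ?w$3) (?w$4)) x = quartic 0 x"
        using v[of "x$1" "x$2"] unfolding cdot_def sum_5 nu_def quartic_def by (simp add: algebra_simps)
    qed
    thus ?thesis by (simp add: vec_eq_iff forall_5)
  qed
  have p: "?p = nu 1 0 - nu 0 1" by (simp add: nu_def vec_eq_iff forall_5)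
  have "B *v ?p = 0" unfolding p matrix_vector_mult_diff_distrib by (simp add: B0)
  moreover have "?p \<noteq> 0" by (simp add: vec_eq_iff forall_5)
  ultimately show False using sm by (auto simp: smooth_quadric_def quadric_def cdot_def)
qed

end

theory Submission
  imports Defs "HOL-Complex_Analysis.Cauchy_Integral_Formula"
begin

text \<open>
  A smooth quadric invariant under all linear substitutions in binary quartics is the zero locus of the
  invariant \<^term>\<open>qI\<close> (\<open>invariant_quadric\<close>), so the quadric and its tangent spaces are explicit.
  An extension \<open>\<omega>\<close> of \<open>\<A>\<close> has to have the same twist, hence degree one, and a homogeneous
  holomorphic function of degree two on the complement of the origin is a quadratic polynomial: its
  restriction to a line that avoids the origin is entire and grows quadratically
  (\<open>homogeneous_quadratic\<close>). Thus \<open>\<omega>\<close> is given by quadratic coefficients, and polarizing them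
  turns everything known about \<open>\<omega>\<close> into identities for one trilinear function \<open>W\<close>
  (\<open>foliation_defines_quadratic_form\<close>): \<open>\<omega>\<close> annihilates the radial field everywhere, it annihilates
  the two vector fields that generate the affine action on the quadric, and it is integrable.

  The linear conditions determine \<open>\<omega>\<close> up to a factor \<open>\<kappa>\<close> and up to the addition of
  \<open>q \<alpha> - \<alpha>(x) dq / 2\<close> with a constant one-form \<open>\<alpha>\<close> and \<open>q =\<close> \<^term>\<open>qI\<close>. Integrability then
  forces \<open>\<kappa> = 0\<close>. To see this it is enough to expand the conditions to first order, almost all of them
  along the tangent line to the rational normal curve at the fourth power \<open>x\<^sup>4\<close>, that is, at the
  quartics \<open>x\<^sup>3 (p x + s y)\<close>. There the pairing of \<open>\<omega>\<close> with tangent vectors of the quadric is proportional to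
  \<open>\<kappa>\<close>, so it vanishes (\<open>vanishes_on_tangent_line\<close>).

  All hypotheses are stable under translations of the affine line, which move this line to all
  quartics with a triple root at a finite point. So the restriction of \<open>\<omega>\<close> to the
  quadric vanishes along a surface, contrary to transversality, which asks for a zero set of
  codimension at least two.
\<close>

section \<open>The quadric invariant under linear substitutions\<close>

lemma cdot_add: "cdot (x + y) z = cdot x z + cdot y z" "cdot x (y + z) = cdot x y + cdot x z"
  by (simp_all only: cdot_def vector_add_component distrib_left distrib_right sum.distrib)

lemma cdot_axis: "cdot (axis i 1) y = y $ i" "cdot y (axis i 1) = y $ i"
  by (simp_all add: cdot_def axis_def if_distrib if_distribR cong: if_cong)

lemma matrix_entry: "(B *v axis j 1) $ i = (B $ i $ j :: complex)"
  by (simp add: matrix_vector_mult_def axis_def if_distrib cong: if_cong)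

text \<open>
  A nondegenerate quadric determines its equation up to a scalar. Fix \<open>x0\<close> off the first quadric. A
  line through \<open>y\<close> in the direction \<open>x0\<close> meets the quadric in two points, counted with multiplicity. If
  they are distinct, then both forms restrict on the line to quadratic polynomials with the same two
  roots, so these are proportional with the ratio of the values at \<open>x0\<close>. The lines that are
  tangent to the quadric are those where a discriminant vanishes, and this discriminant is a nonzero
  polynomial in \<open>y\<close>, because its vanishing would make the first form have rank one.
\<close>
lemma quadric_determines_form:
  fixes B1 B2 :: "complex^5^5"
  assumes sym1: "transpose B1 = B1" and sym2: "transpose B2 = B2"
    and nondegenerate: "\<And>x. B1 *v x = 0 \<Longrightarrow> x = 0"
    and zeros: "\<And>x. cdot x (B1 *v x) = 0 \<Longrightarrow> cdot x (B2 *v x) = 0"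
  obtains l where "\<And>i j. B2 $ i $ j = l * B1 $ i $ j"
proof -
  define b1 b2 where "b1 x y = cdot x (B1 *v y)" and "b2 x y = cdot x (B2 *v y)" for x y
  have sym: "b1 x y = b1 y x" "b2 x y = b2 y x" for x y
    unfolding b1_def b2_def by (rule cdot_symm[OF sym1], rule cdot_symm[OF sym2])
  have lin: "b1 (x + y) z = b1 x z + b1 y z" "b1 z (x + y) = b1 z x + b1 z y"
    "b1 (c *s x) z = c * b1 x z" "b1 z (c *s x) = c * b1 z x"
    "b2 (x + y) z = b2 x z + b2 y z" "b2 z (x + y) = b2 z x + b2 z y"
    "b2 (c *s x) z = c * b2 x z" "b2 z (c *s x) = c * b2 z x" for x y z c
    by (simp_all add: b1_def b2_def cdot_add cdot_scale matrix_vector_right_distrib vector_scalar_commute)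
  have radical: "x = 0" if "\<And>y. b1 y x = 0" for x
  proof (rule nondegenerate)
    show "B1 *v x = 0"
      using that[unfolded b1_def, of "axis i 1" for i] by (simp add: vec_eq_iff cdot_axis)
  qed
  obtain x0 where x0: "b1 x0 x0 \<noteq> 0"
  proof (rule ccontr)
    assume "\<not> thesis"
    hence 0: "b1 x x = 0" for x using that by blast
    have "b1 y x = 0" for x y using 0[of "x + y"] 0[of x] 0[of y] sym(1)[of x y] by (simp add: lin)
    hence "axis 0 1 = (0 :: complex^5)" using radical by blast
    thus False by simp
  qed
  define l where "l = b2 x0 x0 / b1 x0 x0"
  define disc where "disc y = (b1 x0 y)^2 - b1 x0 x0 * b1 y y" for y
  have generic: "b2 y y = l * b1 y y" if "disc y \<noteq> 0" for y
  proof -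
    define r t u where "r = csqrt (disc y)" and "t = (- b1 x0 y + r) / b1 x0 x0"
      and "u = (- b1 x0 y - r) / b1 x0 x0"
    have r: "r^2 = (b1 x0 y)^2 - b1 x0 x0 * b1 y y" "r \<noteq> 0" using that by (simp_all add: r_def disc_def)
    have t: "t * b1 x0 x0 = - b1 x0 y + r" and u: "u * b1 x0 x0 = - b1 x0 y - r" using x0 by (simp_all add: t_def u_def)
    have root: "b2 y y + 2 * a * b2 x0 y + a^2 * b2 x0 x0 = 0"
      if "a * b1 x0 x0 = - b1 x0 y + r \<or> a * b1 x0 x0 = - b1 x0 y - r" for a
    proof -
      have "b1 x0 x0 * (b1 y y + 2 * a * b1 x0 y + a^2 * b1 x0 x0) = 0" using that r(1) by algebra
      hence "b1 y y + 2 * a * b1 x0 y + a^2 * b1 x0 x0 = 0" using x0 by simp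
      hence "b1 (y + a *s x0) (y + a *s x0) = 0" by (simp add: lin sym(1)[of y x0] power2_eq_square algebra_simps)
      hence "b2 (y + a *s x0) (y + a *s x0) = 0" using zeros by (simp add: b1_def b2_def)
      thus ?thesis by (simp add: lin sym(2)[of y x0] power2_eq_square algebra_simps)
    qed
    have tu: "t \<noteq> u" using t u r(2) by auto
    have "(t - u) * (2 * b2 x0 y + (t + u) * b2 x0 x0) = 0" using root[of t] root[of u] t u by algebra
    hence "2 * b2 x0 y + (t + u) * b2 x0 x0 = 0" using tu by (simp only: mult_eq_0_iff right_minus_eq) simp
    hence 1: "2 * b2 x0 y = - (t + u) * b2 x0 x0" by algebra
    have 2: "b2 y y = t * u * b2 x0 x0" using root[of t] t 1 by algebra
    have "b1 x0 x0 * (b1 x0 x0 * t * u - b1 y y) = 0" using t u r(1) by algebra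
    hence "b1 y y = b1 x0 x0 * t * u" using x0 by simp
    thus ?thesis using 2 x0 by (simp add: l_def)
  qed
  obtain z where z: "disc z \<noteq> 0"
  proof (rule ccontr)
    assume "\<not> thesis"
    hence 0: "disc y = 0" for y using that by blast
    define a where "a = B1 *v x0"
    \<comment> \<open>A nonzero vector orthogonal to \<open>x0\<close>; if the discriminant vanished it would lie in the radical.\<close>
    define z :: "complex^5" where "z = (if a$0 = 0 then axis 0 1 else a$1 *s axis 0 1 + (- a$0) *s axis 1 1)"
    have "b1 z x0 = 0" by (simp add: b1_def z_def a_def[symmetric] cdot_diff cdot_scale cdot_axis)
    hence z0: "b1 x0 z = 0" by (simp add: sym)
    have "b1 y z = 0" for y
    proof -
      have "b1 x0 x0 * (2 * b1 y z) = 0"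
        using 0[of "y + z"] 0[of y] 0[of z] z0 unfolding disc_def lin sym(1)[of z y] by algebra
      thus ?thesis using x0 by simp
    qed
    hence "z = 0" by (rule radical)
    moreover have "z \<noteq> 0" by (auto simp: z_def vec_eq_iff forall_5 axis_def)
    ultimately show False by simp
  qed
  have all: "b2 y y = l * b1 y y" for y
  proof -
    \<comment> \<open>Along \<open>y + t z\<close> the difference of the forms times the discriminant is the zero polynomial in \<open>t\<close>.\<close>
    let ?P = "[:b2 y y - l * b1 y y, 2 * (b2 y z - l * b1 y z), b2 z z - l * b1 z z:]"
    let ?D = "[:disc y, 2 * (b1 x0 y * b1 x0 z - b1 x0 x0 * b1 y z), disc z:]"
    have P: "poly ?P t = b2 (y + t *s z) (y + t *s z) - l * b1 (y + t *s z) (y + t *s z)" for t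
      by (simp add: lin sym(1)[of z y] sym(2)[of z y] algebra_simps)
    have D: "poly ?D t = disc (y + t *s z)" for t
      by (simp add: disc_def lin sym(1)[of z y] algebra_simps power2_eq_square)
    have "poly (?P * ?D) t = 0" for t unfolding poly_mult P D using generic[of "y + t *s z"] by auto
    hence "?P * ?D = 0" by (simp only: poly_all_0_iff_0[symmetric]) simp
    hence "?P = 0" using z by (simp only: mult_eq_0_iff) auto
    thus ?thesis by simp
  qed
  have "b2 x y = l * b1 x y" for x y
    using all[of "x + y"] all[of x] all[of y] unfolding lin sym(1)[of y x] sym(2)[of y x] by algebra
  from this[of "axis i 1" "axis j 1" for i j] have "B2 $ i $ j = l * B1 $ i $ j" for i j
    by (simp add: b1_def b2_def cdot_axis matrix_entry)
  thus ?thesis by (rule that)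
qed

text \<open>
  The torus element \<open>mat2 2 0 0 1\<close> multiplies the coordinate \<open>i\<close> by \<open>2 ^ (4 - i)\<close>. Since it preserves the
  quadric, it scales the form, so all nonzero entries of \<open>B\<close> have the same value of \<open>i + j\<close>; because \<open>B\<close>
  has no zero row, this value is four. The three remaining parameters are related by the condition
  that one unipotent substitution moves the null vectors \<open>x\<^sup>4\<close> and \<open>x\<^sup>3 y\<close> to null vectors.
\<close>
lemma invariant_quadric:
  assumes smooth: "smooth_quadric B"
    and invariant: "\<And>h x. invertible h \<Longrightarrow> x \<in> quadric B \<Longrightarrow> subst4 h x \<in> quadric B"
  obtains c where "c \<noteq> 0" "\<And>i j. B $ i $ j = c * BI $ i $ j"
proof -
  have sym: "transpose B = B" using smooth by (simp add: smooth_quadric_def)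
  have symB: "B $ i $ j = B $ j $ i" for i j
    using arg_cong[OF sym, of "\<lambda>B. B $ i $ j"] by (simp add: transpose_def)
  have nondegenerate: "x = 0" if "B *v x = 0" for x
    using smooth that by (auto simp: smooth_quadric_def quadric_def cdot_def)
  have inv: "cdot (subst4 h x) (B *v subst4 h x) = 0" if "invertible h" "cdot x (B *v x) = 0" for h x
  proof (cases "x = 0")
    case True
    hence "subst4 h x = 0" by (simp add: subst4_def)
    thus ?thesis by (simp add: cdot_def)
  next
    case False
    thus ?thesis using invariant[OF that(1), of x] that by (simp add: quadric_def)
  qed
  let ?d = "vec5 16 8 4 2 1 :: complex^5"
  let ?h = "mat2 2 0 0 1"
  define B2 :: "complex^5^5" where "B2 = (\<chi> i j. ?d$i * ?d$j * B$i$j)"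
  have B2: "cdot x (B2 *v x) = cdot (subst4 ?h x) (B *v subst4 ?h x)" for x
    by (simp add: cdot_def matrix_vector_mult_def sum_5 B2_def subst4_def algebra_simps)
  obtain l where l: "\<And>i j. B2 $ i $ j = l * B $ i $ j"
  proof (rule quadric_determines_form[of B B2])
    show "transpose B2 = B2" by (simp add: B2_def transpose_def vec_eq_iff symB mult_ac)
    show "cdot x (B2 *v x) = 0" if "cdot x (B *v x) = 0" for x
      unfolding B2 using that by (intro inv) (simp add: mat2_inv)
  qed (use sym nondegenerate in auto)
  have weight: "(?d$i * ?d$j - l) * B$i$j = 0" for i j
    using l[of i j] by (simp add: B2_def algebra_simps)
  have row: "\<exists>j. B $ i $ j \<noteq> 0" for i
  proof (rule ccontr)
    assume "\<not> ?thesis"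
    hence "B *v axis i 1 = 0" by (simp add: matrix_entry vec_eq_iff symB[of _ i])
    thus False using nondegenerate by fastforce
  qed
  obtain j k where "B $ 0 $ j \<noteq> 0" "B $ 4 $ k \<noteq> 0" using row by blast
  hence "?d$0 * ?d$j = l" "?d$4 * ?d$k = l" using weight[of 0 j] weight[of 4 k] by simp_all
  hence l16: "l = 16" using exhaust_5[of j] exhaust_5[of k] by auto
  have off: "B$0$0 = 0" "B$0$1 = 0" "B$0$2 = 0" "B$0$3 = 0" "B$1$1 = 0" "B$1$2 = 0"
    "B$1$4 = 0" "B$2$3 = 0" "B$2$4 = 0" "B$3$3 = 0" "B$3$4 = 0" "B$4$4 = 0"
    using weight[of 0 0] weight[of 0 1] weight[of 0 2] weight[of 0 3] weight[of 1 1] weight[of 1 2]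
      weight[of 1 4] weight[of 2 3] weight[of 2 4] weight[of 3 3] weight[of 3 4] weight[of 4 4] l16 by simp_all
  note off' = off symB[of 1 0] symB[of 2 0] symB[of 3 0] symB[of 2 1] symB[of 4 1] symB[of 3 2] symB[of 4 2]
    symB[of 4 3] symB[of 4 0] symB[of 3 1]
  have form: "cdot x (B *v x) = 2 * B$0$4 * x$0 * x$4 + 2 * B$1$3 * x$1 * x$3 + B$2$2 * x$2 * x$2" for x
    using off' by (simp add: cdot_def matrix_vector_mult_def sum_5)
  have unipotent: "invertible (mat2 1 1 0 1)" by (simp add: mat2_inv)
  have 1: "B$0$4 + 16 * B$1$3 + 18 * B$2$2 = 0"
    using inv[OF unipotent, of "axis 0 1", unfolded form] by (simp add: subst4_def axis_def) algebra
  have 2: "2 * B$1$3 = - 3 * B$2$2"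
    using inv[OF unipotent, of "axis 1 1", unfolded form] by (simp add: subst4_def axis_def) algebra
  have 3: "B$1$3 = B$2$2 * (-3/2)" using 2 by (simp add: field_simps)
  have 4: "B$0$4 = B$2$2 * 6" using 1 2 by algebra
  have "\<forall>i j. B$i$j = B$2$2 * BI$i$j"
    by (simp add: forall_5 BI_def off' 3 4)
  moreover have "B$2$2 \<noteq> 0"
  proof
    assume "B$2$2 = 0"
    hence "\<forall>j. B$2$j = 0" by (simp add: forall_5 off')
    thus False using row[of 2] by blast
  qed
  ultimately show ?thesis using that by blast
qed

lemma orbit_closure_invariant:
  assumes "invertible h" "x \<in> orbit_closure a"
  shows "subst4 h x \<in> orbit_closure a"
proof -
  obtain k where "h ** k = mat 1" using assms(1) by (auto simp: invertible_def)
  hence "subst4 k (subst4 h x) = x" by (simp add: subst4_subst4 subst4_id)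
  moreover have "subst4 k 0 = 0" by (simp add: subst4_def)
  ultimately have "subst4 h x \<noteq> 0" using assms(2) by (auto simp: orbit_closure_def)
  thus ?thesis using assms closure_orb_subst4 by (simp add: orbit_closure_def orb_def[symmetric])
qed

section \<open>Twisted one-forms on projective space have polynomial coefficients\<close>

lemma norm_smult: "norm (c *s (v::complex^'n)) = cmod c * norm v"
  by (simp add: norm_vec_def norm_mult L2_set_right_distrib)

lemma bounded_linear_smult_left: "bounded_linear (\<lambda>c. c *s (v::complex^'n))"
  by (rule bounded_linear_intro[where K = "norm v"])
     (simp_all add: vector_sadd_rdistrib norm_smult vec_eq_iff)

lemma homogeneous_bound:
  fixes f :: "complex^'n \<Rightarrow> complex"
  assumes cont: "continuous_on (- {0}) f"
    and homogeneous: "\<And>c x. c \<noteq> 0 \<Longrightarrow> x \<noteq> 0 \<Longrightarrow> f (c *s x) = c^2 * f x" and zero: "f 0 = 0"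
  obtains K where "K \<ge> 0" "\<And>x. cmod (f x) \<le> K * (norm x)^2"
proof -
  have "continuous_on (sphere 0 1) f" by (rule continuous_on_subset[OF cont]) auto
  hence "bounded (f ` sphere 0 1)" by (intro compact_imp_bounded compact_continuous_image) auto
  then obtain K where K: "K > 0" "\<And>u. norm u = 1 \<Longrightarrow> cmod (f u) \<le> K"
    by (auto simp: bounded_pos)
  have "cmod (f x) \<le> K * (norm x)^2" for x
  proof (cases "x = 0")
    case True thus ?thesis by (simp add: zero)
  next
    case False
    define u where "u = complex_of_real (1 / norm x) *s x"
    have u: "norm u = 1" using False by (simp add: u_def norm_smult norm_divide)
    have x: "x = complex_of_real (norm x) *s u" using False by (simp add: u_def vector_smult_assoc)
    have "u \<noteq> 0" using u by auto
    hence "f x = (complex_of_real (norm x))^2 * f u" using homogeneous[of "complex_of_real (norm x)" u] x False by simp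
    hence "cmod (f x) = (norm x)^2 * cmod (f u)" by (simp add: norm_mult norm_power)
    thus ?thesis using K(2)[OF u] by (simp add: mult.commute mult_right_mono)
  qed
  thus ?thesis using that[of K] K(1) by simp
qed

text \<open>
  The function \<open>t \<mapsto> f (x + t v)\<close> is entire of quadratic growth, so it is a polynomial of degree at most
  two by the theorem of Liouville. Its constant coefficient is \<open>f x\<close>, its linear coefficient is a derivative, and its
  leading coefficient is \<open>f v\<close> by homogeneity and continuity of \<open>f\<close> at \<open>v\<close>.
\<close>
lemma homogeneous_on_line:
  fixes f :: "complex^'n \<Rightarrow> complex"
  assumes deriv: "\<And>x. x \<noteq> 0 \<Longrightarrow> (f has_derivative f' x) (at x)"
    and linear: "\<And>x c v. x \<noteq> 0 \<Longrightarrow> f' x (c *s v) = c * f' x v"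
    and homogeneous: "\<And>c x. c \<noteq> 0 \<Longrightarrow> x \<noteq> 0 \<Longrightarrow> f (c *s x) = c^2 * f x" and zero: "f 0 = 0"
    and line: "\<And>t. x + t *s v \<noteq> 0" and v: "v \<noteq> 0"
  shows "f (x + v) = f x + f' x v + f v"
proof -
  define g where "g t = f (x + t *s v)" for t
  have x: "x \<noteq> 0" using line[of 0] by simp
  have isCont: "isCont f y" if "y \<noteq> 0" for y
    using deriv[OF that] by (rule has_derivative_continuous)
  have "continuous_on (- {0}) f" using isCont by (intro continuous_at_imp_continuous_on) auto
  then obtain K where K: "K \<ge> 0" "\<And>x. cmod (f x) \<le> K * (norm x)^2"
    using homogeneous_bound[of f] homogeneous zero by metis
  have path: "((\<lambda>t. x + t *s v) has_derivative (\<lambda>h. h *s v)) (at t)" for t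
    using bounded_linear_imp_has_derivative[OF bounded_linear_smult_left[of v]]
    by (auto intro!: derivative_eq_intros)
  have g': "(g has_field_derivative f' (x + t *s v) v) (at t)" for t
  proof -
    have "(g has_derivative (\<lambda>h. f' (x + t *s v) (h *s v))) (at t)"
      unfolding g_def using has_derivative_compose[OF path deriv[OF line]] by simp
    moreover have "(\<lambda>h. f' (x + t *s v) (h *s v)) = (*) (f' (x + t *s v) v)"
      using linear[OF line] by (auto simp: mult.commute)
    ultimately show ?thesis by (simp add: has_field_derivative_def)
  qed
  hence hol: "g holomorphic_on UNIV"
    by (auto simp: holomorphic_on_def field_differentiable_def)
  have growth: "cmod (g t) \<le> K * (norm x + norm v)^2 * cmod t ^ 2" if "1 \<le> cmod t" for t
  proof -
    have "norm (x + t *s v) \<le> norm x + cmod t * norm v" by (metis norm_smult norm_triangle_ineq)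
    also have "\<dots> \<le> cmod t * (norm x + norm v)" using mult_right_mono[OF that, of "norm x"] by (simp add: algebra_simps)
    finally have "(norm (x + t *s v))^2 \<le> (cmod t * (norm x + norm v))^2" by (intro power_mono) auto
    hence "K * (norm (x + t *s v))^2 \<le> K * (cmod t * (norm x + norm v))^2" using K(1) by (rule mult_left_mono)
    thus ?thesis using K(2)[of "x + t *s v"] by (simp add: g_def power_mult_distrib mult_ac)
  qed
  define a where "a k = (deriv ^^ k) g 0 / fact k" for k
  have g: "g t = a 0 + a 1 * t + a 2 * t^2" for t
    using Liouville_polynomial[OF hol, of 1 "K * (norm x + norm v)^2" 2 t] growth by (simp add: a_def numeral_2_eq_2)
  have a0: "a 0 = f x" using g[of 0] by (simp add: g_def)
  have "((\<lambda>t. a 0 + a 1 * t + a 2 * t^2) has_field_derivative a 1) (at 0)"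
    by (auto intro!: derivative_eq_intros)
  hence "(g has_field_derivative a 1) (at 0)" using g by presburger
  hence a1: "a 1 = f' x v" using DERIV_unique[OF g'[of 0]] by simp
  have "((\<lambda>t. f (t *s x + v)) \<longlongrightarrow> f v) (at 0)"
  proof (rule isCont_tendsto_compose[of v f, OF isCont[OF v]])
    have "((\<lambda>t. t *s x + v) \<longlongrightarrow> 0 *s x + v) (at 0)"
      by (intro tendsto_intros bounded_linear.tendsto[OF bounded_linear_smult_left])
    thus "((\<lambda>t. t *s x + v) \<longlongrightarrow> v) (at 0)" by simp
  qed
  moreover have "((\<lambda>t. f (t *s x + v)) \<longlongrightarrow> a 2) (at 0)"
  proof -
    have "((\<lambda>t. a 0 * t^2 + a 1 * t + a 2) \<longlongrightarrow> a 0 * 0^2 + a 1 * 0 + a 2) (at 0)"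
      by (intro tendsto_intros)
    moreover have "f (t *s x + v) = a 0 * t^2 + a 1 * t + a 2" if "t \<noteq> 0" for t
    proof -
      have "t *s x + v = t *s (x + (1/t) *s v)" using that by (simp add: vec_eq_iff algebra_simps)
      hence "f (t *s x + v) = t^2 * g (1/t)" using homogeneous[OF that line[of "1/t"]] by (simp add: g_def)
      also have "\<dots> = a 0 * t^2 + a 1 * t + a 2"
        unfolding g using that by (simp add: distrib_left power_divide) (simp add: power2_eq_square)
      finally show ?thesis .
    qed
    ultimately show ?thesis
      by (simp cong: Lim_cong_within)
  qed
  ultimately have "a 2 = f v" using tendsto_unique[OF trivial_limit_at] by blast
  thus ?thesis using g[of 1] a0 a1 by (simp add: g_def)
qed

text \<open>
  The conclusion says that \<open>f\<close> is a quadratic form: the mixed term \<open>f (x + v) - f x - f v\<close> is symmetric in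
  \<open>x\<close> and \<open>v\<close>, and it is linear in \<open>v\<close> since it is a derivative.
  The remaining case of a line through the origin is Euler's identity.
\<close>
lemma homogeneous_quadratic:
  fixes f :: "complex^'n \<Rightarrow> complex"
  assumes deriv: "\<And>x. x \<noteq> 0 \<Longrightarrow> (f has_derivative f' x) (at x)"
    and linear: "\<And>x c v. x \<noteq> 0 \<Longrightarrow> f' x (c *s v) = c * f' x v"
    and homogeneous: "\<And>c x. c \<noteq> 0 \<Longrightarrow> x \<noteq> 0 \<Longrightarrow> f (c *s x) = c^2 * f x" and zero: "f 0 = 0"
    and x: "x \<noteq> 0"
  shows "f (x + v) = f x + f' x v + f v"
proof (cases "\<exists>c. v = c *s x")
  case True
  then obtain c where v: "v = c *s x" by blast
  have hom: "f (a *s x) = a^2 * f x" for a using homogeneous[OF _ x, of a] zero by (cases "a = 0") auto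
  have path: "((\<lambda>t. x + t *s x) has_derivative (\<lambda>h. h *s x)) (at 0)"
    using bounded_linear_imp_has_derivative[OF bounded_linear_smult_left[of x]]
    by (auto intro!: derivative_eq_intros)
  have "((\<lambda>t. f (x + t *s x)) has_derivative (\<lambda>h. f' x (h *s x))) (at 0)"
    using has_derivative_compose[OF path, of f "f' x"] deriv[OF x] by simp
  moreover have "(\<lambda>h. f' x (h *s x)) = (*) (f' x x)" using linear[OF x] by (auto simp: mult.commute)
  moreover have "f (x + t *s x) = (1 + t)^2 * f x" for t
    using hom[of "1 + t"] by (simp add: vector_sadd_rdistrib)
  ultimately have "((\<lambda>t. (1 + t)^2 * f x) has_field_derivative f' x x) (at 0)"
    by (simp add: has_field_derivative_def)
  moreover have "((\<lambda>t. (1 + t)^2 * f x) has_field_derivative 2 * f x) (at 0)"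
    by (auto intro!: derivative_eq_intros)
  ultimately have euler: "f' x x = 2 * f x" by (rule DERIV_unique)
  have "f (x + v) = (1 + c)^2 * f x" using hom[of "1 + c"] by (simp add: v vector_sadd_rdistrib)
  thus ?thesis using euler linear[OF x, of c x] hom[of c] by (simp add: v algebra_simps power2_eq_square)
next
  case False
  have "x + t *s v \<noteq> 0" for t
  proof
    assume 0: "x + t *s v = 0"
    hence "t \<noteq> 0" using x by auto
    hence "v = (- 1 / t) *s x" using 0 by (simp add: vec_eq_iff field_simps eq_neg_iff_add_eq_0 add.commute)
    thus False using False by blast
  qed
  moreover have "v \<noteq> 0" using False[simplified] by (metis vector_smult_lzero)
  ultimately show ?thesis using homogeneous_on_line[of f f' x v] assms by blast
qed

text \<open>
  At the origin, where a form on the cone is unconstrained, the value is zero, so that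
  homogeneity holds at all points.
\<close>
definition coefficients :: "(complex^5 \<Rightarrow> complex^5 \<Rightarrow> complex) \<Rightarrow> complex^5 \<Rightarrow> complex^5" where
  "coefficients \<omega> x = (if x = 0 then 0 else \<chi> i. \<omega> x (axis i 1))"

text \<open>
  On projective space all vectors are tangent to the cone, so the coefficients of a local
  representative are determined by the form and the local representatives agree on overlaps.
\<close>
lemma twisted_form_on_P4:
  assumes tw: "twisted_one_form (UNIV - {0}) (\<lambda>x. UNIV) k \<omega>"
  shows "local_representative (UNIV - {0}) (\<lambda>x. UNIV) \<omega> (UNIV - {0}) (coefficients \<omega>)"
proof -
  have "\<exists>U A. x \<in> U \<and> local_representative (UNIV - {0}) (\<lambda>x. UNIV) \<omega> U A" if "x \<noteq> 0" for x
    using tw that by (simp add: twisted_one_form_def)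
  then obtain U A where UA: "\<And>x. x \<noteq> 0 \<Longrightarrow> x \<in> U x"
    "\<And>x. x \<noteq> 0 \<Longrightarrow> local_representative (UNIV - {0}) (\<lambda>x. UNIV) \<omega> (U x) (A x)"
    by metis
  have coeff: "coefficients \<omega> y = A x y" if "x \<noteq> 0" "y \<noteq> 0" "y \<in> U x" for x y
    using UA(2)[OF that(1)] that
    by (simp add: local_representative_def coefficients_def cdot_axis vec_eq_iff[of _ "A x y"])
  have "\<omega> x v = cdot (coefficients \<omega> x) v" if "x \<noteq> 0" for x v
    using UA[OF that] coeff[OF that that] that by (simp add: local_representative_def)
  moreover have "\<exists>f'. (coefficients \<omega> has_derivative f') (at x) \<and> (\<forall>c v. f' (c *s v) = c *s f' v)" if x: "x \<noteq> 0" for x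
  proof -
    obtain f' where f': "(A x has_derivative f') (at x)" "\<forall>c v. f' (c *s v) = c *s f' v"
      using UA[OF x] by (auto simp: local_representative_def holomorphic_map_on_def)
    have "(coefficients \<omega> has_derivative f') (at x)"
    proof (rule has_derivative_transform_within_open[OF f'(1)])
      show "open (U x \<inter> (UNIV - {0}))" using UA[OF x] by (auto simp: local_representative_def intro!: open_Int)
    qed (use UA(1)[OF x] x coeff[OF x] in auto)
    thus ?thesis using f'(2) by blast
  qed
  ultimately show ?thesis by (auto simp: local_representative_def holomorphic_map_on_def open_delete)
qed

text \<open>
  A form of weight three has coefficients of degree two, because the differentials of the
  coordinates contribute one.
\<close>
lemma quadratic_form_on_P4:
  assumes tw: "twisted_one_form (UNIV - {0}) (\<lambda>x. UNIV) 3 \<omega>"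
  shows "x \<noteq> 0 \<Longrightarrow> \<omega> x v = cdot (coefficients \<omega> x) v"
    and "coefficients \<omega> (c *s x) = c^2 *s coefficients \<omega> x"
    and "x \<noteq> 0 \<Longrightarrow> frechet_derivative (coefficients \<omega>) (at x) v = 
         coefficients \<omega> (x + v) - coefficients \<omega> x - coefficients \<omega> v"
    and "x \<noteq> 0 \<Longrightarrow> frechet_derivative (coefficients \<omega>) (at x) (v + w) =
         frechet_derivative (coefficients \<omega>) (at x) v + frechet_derivative (coefficients \<omega>) (at x) w"
    and "x \<noteq> 0 \<Longrightarrow> frechet_derivative (coefficients \<omega>) (at x) (c *s v) =
         c *s frechet_derivative (coefficients \<omega>) (at x) v"
proof -
  let ?A = "coefficients \<omega>"
  note rep = twisted_form_on_P4[OF tw]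
  show form: "\<omega> x v = cdot (?A x) v" if "x \<noteq> 0" for x v
    using rep that by (simp add: local_representative_def)
  show hom: "?A (c *s x) = c^2 *s ?A x" for c x
  proof (cases "c = 0 \<or> x = 0")
    case True thus ?thesis by (auto simp: coefficients_def vec_eq_iff)
  next
    case False
    have "\<omega> (c *s x) (c *s v) = c^3 * \<omega> x v" for v
      using tw False by (simp add: twisted_one_form_def power_int_def)
    hence "c * ?A (c *s x) $ i = c^3 * ?A x $ i" for i
      using form[of "c *s x" "c *s axis i 1"] form[of x "axis i 1"] False by (simp add: cdot_axis cdot_scale)
    thus ?thesis using False by (simp add: vec_eq_iff eval_nat_numeral)
  qed
  define D where "D x = frechet_derivative ?A (at x)" for x
  have D: "(?A has_derivative D x) (at x)" "D x (c *s v) = c *s D x v" if x: "x \<noteq> 0" for x c v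
  proof -
    have "holomorphic_map_on (UNIV - {0}) ?A" using rep by (simp add: local_representative_def)
    then obtain f' where f': "(?A has_derivative f') (at x)" "\<forall>c v. f' (c *s v) = c *s f' v"
      using x unfolding holomorphic_map_on_def by blast
    have "D x = f'" unfolding D_def by (rule frechet_derivative_at[OF f'(1), symmetric])
    thus "(?A has_derivative D x) (at x)" "D x (c *s v) = c *s D x v" using f' by auto
  qed
  show "frechet_derivative ?A (at x) (c *s v) = c *s frechet_derivative ?A (at x) v" if "x \<noteq> 0"
    using D(2)[OF that] by (simp add: D_def)
  show "frechet_derivative ?A (at x) (v + w) = frechet_derivative ?A (at x) v + frechet_derivative ?A (at x) w" if "x \<noteq> 0"
    using has_derivative_linear[OF D(1)[OF that]] by (simp add: D_def linear_add)
  show "frechet_derivative ?A (at x) v = ?A (x + v) - ?A x - ?A v" if x: "x \<noteq> 0"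
  proof -
    have "?A (x + v) $ i = ?A x $ i + D x v $ i + ?A v $ i" for i
    proof (rule homogeneous_quadratic[where f' = "\<lambda>x v. D x v $ i"])
      show "((\<lambda>x. ?A x $ i) has_derivative (\<lambda>v. D x v $ i)) (at x)" if "x \<noteq> 0" for x
        by (rule bounded_linear.has_derivative[OF bounded_linear_vec_nth D(1)[OF that]])
      show "?A 0 $ i = 0" by (simp add: coefficients_def)
    qed (use D(2) hom x in auto)
    thus ?thesis by (simp add: D_def vec_eq_iff)
  qed
qed

section \<open>The vector fields of the affine group\<close>

text \<open>
  The velocities, at the identity, of the substitutions \<open>x \<mapsto> x + c y\<close> and \<open>x \<mapsto> e\<^sup>z x\<close>. Together with
  the radial field they span the tangent spaces of the orbits of the affine group.
\<close>
definition translation_field :: "complex^5 \<Rightarrow> complex^5" where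
  "translation_field x = vec5 0 (4 * x$0) (3 * x$1) (2 * x$2) (x$3)"

definition scaling_field :: "complex^5 \<Rightarrow> complex^5" where
  "scaling_field x = vec5 (4 * x$0) (3 * x$1) (2 * x$2) (x$3) 0"

lemma has_derivative_vec:
  fixes f :: "'a::real_normed_vector \<Rightarrow> complex^'n"
  assumes "\<And>i. ((\<lambda>x. f x $ i) has_derivative (\<lambda>h. f' h $ i)) F"
  shows "(f has_derivative f') F"
proof -
  have "((\<lambda>x. \<Sum>i\<in>UNIV. f x $ i *s axis i 1) has_derivative (\<lambda>h. \<Sum>i\<in>UNIV. f' h $ i *s axis i 1)) F"
    by (intro has_derivative_sum bounded_linear.has_derivative[OF bounded_linear_smult_left] assms)
  thus ?thesis by (simp add: basis_expansion)
qed

text \<open>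
  Tangent vectors of orbits are defined by curves with a real parameter; the curves used below extend
  to a complex parameter, where derivatives are easier to compute.
\<close>
lemma has_vector_derivative_on_reals:
  fixes f :: "complex \<Rightarrow> complex^'n"
  assumes "\<And>i. ((\<lambda>z. f z $ i) has_field_derivative v $ i) (at 0)"
  shows "((\<lambda>t. f (of_real t)) has_vector_derivative v) (at 0)"
  unfolding has_vector_derivative_def
proof (rule has_derivative_vec)
  fix i
  have "((\<lambda>t. f (of_real t) $ i) has_vector_derivative v $ i) (at 0)"
    using has_vector_derivative_real_field[of "\<lambda>z. f z $ i" "v $ i" 0 UNIV] assms[of i] by simp
  thus "((\<lambda>t. f (of_real t) $ i) has_derivative (\<lambda>h. (h *\<^sub>R v) $ i)) (at 0)"
    by (simp add: has_vector_derivative_def)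
qed

lemma act_inverse:
  assumes "g ** h = mat 1" "h ** g = mat 1"
  shows "act g x = subst4 h x"
proof -
  have "invertible g" using assms by (auto simp: invertible_def)
  hence "matrix_inv g = h"
    using matrix_inv_invertible[of g] assms by (metis matrix_mul_assoc matrix_mul_lid matrix_mul_rid)
  thus ?thesis by (simp add: act_eq)
qed

lemma mat2_eq: "g = h \<longleftrightarrow> g$1$1 = h$1$1 \<and> g$1$2 = h$1$2 \<and> g$2$1 = h$2$1 \<and> g$2$2 = h$2$2"
  for g h :: "complex^2^2"
  by (auto simp: vec_eq_iff forall_2)

lemma subst4_translation: "subst4 (mat2 1 c 0 1) x = vec5 (x$0) (4 * c * x$0 + x$1)
    (6 * c^2 * x$0 + 3 * c * x$1 + x$2) (4 * c^3 * x$0 + 3 * c^2 * x$1 + 2 * c * x$2 + x$3)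
    (c^4 * x$0 + c^3 * x$1 + c^2 * x$2 + c * x$3 + x$4)"
  by (simp add: subst4_def vec_eq_iff forall_5 algebra_simps)

lemma subst4_diagonal:
  "subst4 (mat2 s 0 0 1) x = vec5 (s^4 * x$0) (s^3 * x$1) (s^2 * x$2) (s * x$3) (x$4)"
  by (simp add: subst4_def vec_eq_iff forall_5 algebra_simps)

lemma upper_triangular_affine:
  assumes "p \<noteq> 0" "t \<noteq> 0" shows "mat2 p q 0 t \<in> affine_group"
proof -
  have "mat2 p q 0 t *v infinity_pt = p *s infinity_pt"
    by (simp add: vec_eq_iff forall_2 matrix_vector_mult_def infinity_pt_def axis_def sum_2)
  thus ?thesis using assms by (auto simp: affine_group_def mat2_inv)
qed

lemma translation_field_tangent: "translation_field x \<in> affine_orbit_tangent x"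
proof -
  define \<gamma> :: "real \<Rightarrow> complex^2^2" where "\<gamma> t = mat2 1 (- of_real t) 0 1" for t
  have \<gamma>: "\<gamma> t = mat 1 + t *\<^sub>R mat2 0 (-1) 0 0" for t
    by (simp add: \<gamma>_def mat2_eq mat_def scaleR_conv_of_real[where 'a = complex])
  have act: "act (\<gamma> t) x = subst4 (mat2 1 (of_real t) 0 1) x" for t
    by (rule act_inverse) (simp_all add: \<gamma>_def mat2_eq mat_def matrix_matrix_mult_def sum_2)
  have "\<forall>t. \<gamma> t \<in> affine_group"
    by (simp add: \<gamma>_def upper_triangular_affine)
  moreover have "\<gamma> 0 = mat 1" by (simp add: \<gamma>)
  moreover have "\<gamma> differentiable at 0" unfolding \<gamma> by (intro derivative_intros)
  moreover have "((\<lambda>t. act (\<gamma> t) x) has_vector_derivative translation_field x) (at 0)"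
    unfolding act
  proof (rule has_vector_derivative_on_reals)
    fix i :: 5
    show "((\<lambda>c. subst4 (mat2 1 c 0 1) x $ i) has_field_derivative translation_field x $ i) (at 0)"
      unfolding subst4_translation translation_field_def
      using exhaust_5[of i] by (elim disjE) (auto intro!: derivative_eq_intros)
  qed
  ultimately show ?thesis unfolding affine_orbit_tangent_def by blast
qed

lemma scaling_field_tangent: "scaling_field x \<in> affine_orbit_tangent x"
proof -
  \<comment> \<open>The exponential keeps the matrix invertible for all real parameters.\<close>
  define \<gamma> :: "real \<Rightarrow> complex^2^2" where "\<gamma> t = mat2 (of_real (exp (- t))) 0 0 1" for t
  have \<gamma>: "\<gamma> t = mat2 0 0 0 1 + exp (- t) *\<^sub>R mat2 1 0 0 0" for t
    by (simp add: \<gamma>_def mat2_eq scaleR_conv_of_real[where 'a = complex])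
  have act: "act (\<gamma> t) x = subst4 (mat2 (of_real (exp t)) 0 0 1) x" for t
    by (rule act_inverse)
       (simp_all add: \<gamma>_def mat2_eq mat_def matrix_matrix_mult_def sum_2 exp_minus flip: of_real_mult)
  have "\<forall>t. \<gamma> t \<in> affine_group"
    by (simp add: \<gamma>_def upper_triangular_affine)
  moreover have "\<gamma> 0 = mat 1" by (simp add: \<gamma>_def mat2_eq mat_def)
  moreover have "((\<lambda>t::real. exp (- t)) has_derivative (\<lambda>h. - h)) (at 0)"
    by (auto intro!: derivative_eq_intros)
  hence "\<gamma> differentiable at 0"
    unfolding \<gamma> by (intro derivative_intros differentiableI)
  moreover have "((\<lambda>t. act (\<gamma> t) x) has_vector_derivative scaling_field x) (at 0)"
    unfolding act exp_of_real[symmetric]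
  proof (rule has_vector_derivative_on_reals)
    fix i :: 5
    show "((\<lambda>z. subst4 (mat2 (exp z) 0 0 1) x $ i) has_field_derivative scaling_field x $ i) (at 0)"
      unfolding subst4_diagonal scaling_field_def
      using exhaust_5[of i] by (elim disjE) (auto intro!: derivative_eq_intros)
  qed
  ultimately show ?thesis unfolding affine_orbit_tangent_def by blast
qed

definition translate :: "complex \<Rightarrow> complex^5 \<Rightarrow> complex^5" where
  "translate c = subst4 (mat2 1 c 0 1)"

lemma translate_linear:
  "translate c (x + y) = translate c x + translate c y" "translate c (a *s x) = a *s translate c x"
  by (simp_all add: translate_def subst4_def vec_eq_iff forall_5 algebra_simps)

lemma translate_inverse: "translate c (translate (- c) x) = x"
proof -
  have "mat2 1 (- c) 0 1 ** mat2 1 c 0 1 = mat 1"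
    by (simp add: mat2_eq mat_def matrix_matrix_mult_def sum_2)
  thus ?thesis by (simp add: translate_def subst4_subst4 subst4_id)
qed

lemma qI_translate: "qI (translate c x) = qI x"
  by (simp add: translate_def qI_subst4)

lemma polar_BI: "cdot v (BI *v x) = 6 * (v$0 * x$4 + v$4 * x$0) - 3/2 * (v$1 * x$3 + v$3 * x$1) + v$2 * x$2"
  by (simp add: cdot_def matrix_vector_mult_def sum_5 BI_def algebra_simps)

lemma polar_translate: "cdot (translate c v) (BI *v translate c x) = cdot v (BI *v x)"
  unfolding polar_BI by (simp add: translate_def subst4_def field_simps) algebra

text \<open>
  Conjugation by a translation fixes the translation field and adds a multiple of it to the scaling
  field, so the span of the two fields is preserved.
\<close>
lemma translate_fields:
  "translate c (translation_field x) = translation_field (translate c x)"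
  "translate c (scaling_field x) = scaling_field (translate c x) + c *s translation_field (translate c x)"
  by (simp_all add: translate_def subst4_def translation_field_def scaling_field_def vec_eq_iff forall_5
      algebra_simps power2_eq_square power3_eq_cube power4_eq_xxxx)

section \<open>Integrable quadratic forms tangent to the affine orbits\<close>

text \<open>
  For a one-form \<open>\<omega>\<close> with quadratic coefficients, \<open>W\<close> is the polarization: \<open>W x x v\<close> is twice the value
  of \<open>\<omega>\<close> at \<open>x\<close> on \<open>v\<close>, and \<open>W x u v\<close> is the derivative of \<open>x \<mapsto> \<omega> x v\<close> in the direction \<open>u\<close>. Hence
  the exterior derivative of \<open>\<omega>\<close> at \<open>x\<close> is \<open>W x v w - W x w v\<close>, and the last assumption is
  integrability.
\<close>
locale affine_invariant_quadratic_form =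
  fixes W :: "complex^5 \<Rightarrow> complex^5 \<Rightarrow> complex^5 \<Rightarrow> complex"
  assumes sym: "W x y v = W y x v"
    and add_left: "W (x + y) z v = W x z v + W y z v"
    and scale_left: "W (c *s x) z v = c * W x z v"
    and add_arg: "W x y (u + v) = W x y u + W x y v"
    and scale_arg: "W x y (c *s v) = c * W x y v"
    and radial: "W x x x = 0"
    and translation: "qI x = 0 \<Longrightarrow> W x x (translation_field x) = 0"
    and scaling: "qI x = 0 \<Longrightarrow> W x x (scaling_field x) = 0"
    and integrable: "W x x u * (W x v w - W x w v) + W x x v * (W x w u - W x u w)
      + W x x w * (W x u v - W x v u) = 0"
begin

lemma add_right: "W z (x + y) v = W z x v + W z y v"
  by (metis sym add_left)

lemma scale_right: "W z (c *s x) v = c * W z x v"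
  by (metis sym scale_left)

lemmas expand = add_left add_right add_arg scale_left scale_right scale_arg

text \<open>
  If the cubic form \<open>x \<mapsto> W x x (G x)\<close> vanishes along a curve through \<open>x\<close> with velocity \<open>v\<close>, then so does its
  derivative at \<open>x\<close> in the direction \<open>v\<close>. A curve of degree two is allowed because a tangent line of a quadric need not
  lie on it.
\<close>
lemma tangency:
  assumes G_add: "\<And>a b. G (a + b) = G a + G b" and G_scale: "\<And>c a. G (c *s a) = c *s G a"
    and zero: "\<And>t. W (x + t *s v + t^2 *s z) (x + t *s v + t^2 *s z) (G (x + t *s v + t^2 *s z)) = 0"
  shows "2 * W x v (G x) + W x x (G v) = 0"
proof -
  \<comment> \<open>The cubic form along the curve, as a polynomial in \<open>t\<close>; only its linear coefficient matters.\<close>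
  let ?p = "[:W x x (G x), 2 * W x v (G x) + W x x (G v),
    W x x (G z) + 2 * W x v (G v) + (W v v (G x) + 2 * W x z (G x)),
    2 * W x v (G z) + (W v v (G v) + 2 * W x z (G v)) + 2 * W v z (G x),
    (W v v (G z) + 2 * W x z (G z)) + 2 * W v z (G v) + W z z (G x),
    2 * W v z (G z) + W z z (G v), W z z (G z):]"
  have "poly ?p t = W (x + t *s v + t^2 *s z) (x + t *s v + t^2 *s z) (G (x + t *s v + t^2 *s z))" for t
    unfolding G_add G_scale expand sym[of v x] sym[of z x] sym[of z v]
    by (simp add: algebra_simps power2_eq_square)
  hence "?p = 0" using zero by (simp only: poly_all_0_iff_0[symmetric]) simp
  thus ?thesis by simp
qed

lemma radial_polarized: "2 * W x v x + W x x v = 0"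
  using tangency[of "\<lambda>a. a" x v 0] radial by simp

end

lemma cubic_coefficients_zero:
  fixes a0 :: complex
  assumes "\<And>s. s \<noteq> 0 \<Longrightarrow> a0 + a1 * s + a2 * s^2 + a3 * s^3 = 0"
  shows "a0 = 0" "a1 = 0" "a2 = 0" "a3 = 0"
proof -
  have "poly [:0,a0,a1,a2,a3:] s = 0" for s
    using assms[of s] by (cases "s = 0") (simp_all add: algebra_simps eval_nat_numeral)
  hence "[:0,a0,a1,a2,a3:] = 0" by (simp only: poly_all_0_iff_0[symmetric]) simp
  thus "a0 = 0" "a1 = 0" "a2 = 0" "a3 = 0" by simp_all
qed

lemma quadratic_coefficients_zero:
  fixes a0 :: complex
  assumes "\<And>s. s \<noteq> 0 \<Longrightarrow> a0 + a1 * s + a2 * s^2 = 0"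
  shows "a0 = 0" "a1 = 0" "a2 = 0"
  using cubic_coefficients_zero[of a0 a1 a2 0] assms by simp_all

abbreviation e :: "5 \<Rightarrow> complex^5" where "e i \<equiv> axis i 1"

context affine_invariant_quadratic_form begin

abbreviation "n i j k \<equiv> W (e i) (e j) (e k)"

lemma field_linear:
  "translation_field (a + b) = translation_field a + translation_field b"
  "translation_field (c *s a) = c *s translation_field a"
  "scaling_field (a + b) = scaling_field a + scaling_field b"
  "scaling_field (c *s a) = c *s scaling_field a"
  by (simp_all add: translation_field_def scaling_field_def vec_eq_iff forall_5 algebra_simps)

lemma field_basis:
  "translation_field (e 0) = 4 *s e 1" "translation_field (e 1) = 3 *s e 2"
  "translation_field (e 2) = 2 *s e 3" "translation_field (e 3) = e 4" "translation_field (e 4) = 0"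
  "scaling_field (e 0) = 4 *s e 0" "scaling_field (e 1) = 3 *s e 1"
  "scaling_field (e 2) = 2 *s e 2" "scaling_field (e 3) = e 3" "scaling_field (e 4) = 0"
  by (simp_all add: translation_field_def scaling_field_def vec_eq_iff forall_5 axis_def)

lemma tangent_fields:
  assumes "\<And>t. qI (x + t *s v + t^2 *s z) = 0"
  shows "2 * W x v (translation_field x) + W x x (translation_field v) = 0"
    and "2 * W x v (scaling_field x) + W x x (scaling_field v) = 0"
  using tangency[of translation_field x v z] tangency[of scaling_field x v z]
    translation[OF assms] scaling[OF assms] by (simp_all add: field_linear)

lemma sym_basis: "n 1 0 k = n 0 1 k" "n 3 2 k = n 2 3 k"
  by (rule sym)+

text \<open>
  From here on, the conditions are expanded along \<open>e 0 + s *s e 1\<close>, the quartics \<open>x\<^sup>3 (x + s y)\<close>. At such a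
  point, for \<open>s\<close> nonzero, the radial field and the two affine fields span \<open>e 0\<close>, \<open>e 1\<close>, \<open>e 2\<close>.
\<close>
lemma vanishes_on_osculating_plane:
  "n 0 0 0 = 0" "n 0 1 0 = 0" "n 1 1 0 = 0" "n 0 0 1 = 0" "n 0 1 1 = 0" "n 1 1 1 = 0"
  "n 0 0 2 = 0" "n 0 1 2 = 0" "n 1 1 2 = 0"
proof -
  let ?x = "\<lambda>s. e 0 + s *s e 1"
  have q: "qI (?x s) = 0" for s by (simp add: qI_def axis_def)
  have R: "W (?x s) (?x s) (e 0) + s * W (?x s) (?x s) (e 1) = 0" for s
    using radial[of "?x s"] by (simp only: add_arg scale_arg)
  have Y: "4 * W (?x s) (?x s) (e 0) + 3 * s * W (?x s) (?x s) (e 1) = 0" for s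
    using scaling[OF q[of s]] by (simp only: add_arg scale_arg field_linear field_basis mult_ac)
  have X: "4 * W (?x s) (?x s) (e 1) + 3 * s * W (?x s) (?x s) (e 2) = 0" for s
    using translation[OF q[of s]] by (simp only: add_arg scale_arg field_linear field_basis mult_ac)
  have z: "W (?x s) (?x s) (e 0) = 0"
     "W (?x s) (?x s) (e 1) = 0" "W (?x s) (?x s) (e 2) = 0"
     if "s \<noteq> 0" for s
  proof -
    show 0: "W (?x s) (?x s) (e 0) = 0" using R[of s] Y[of s] by algebra
    show 1: "W (?x s) (?x s) (e 1) = 0" using R[of s] 0 that by simp
    show "W (?x s) (?x s) (e 2) = 0" using X[of s] 1 that by simp
  qed
  have *: "n 0 0 k + 2 * n 0 1 k * s + n 1 1 k * s^2 = 0" if "s \<noteq> 0" "k = 0 \<or> k = 1 \<or> k = 2" for k s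
  proof -
    have "n 0 0 k + 2 * n 0 1 k * s + n 1 1 k * s^2 = W (?x s) (?x s) (e k)"
      by (simp add: expand sym_basis algebra_simps power2_eq_square)
    thus ?thesis using z[OF that(1)] that(2) by auto
  qed
  note ** = quadratic_coefficients_zero[OF *, simplified]
  show "n 0 0 0 = 0" "n 0 1 0 = 0" "n 1 1 0 = 0" "n 0 0 1 = 0" "n 0 1 1 = 0" "n 1 1 1 = 0"
    "n 0 0 2 = 0" "n 0 1 2 = 0" "n 1 1 2 = 0" using **[of 0] **[of 1] **[of 2] by simp_all
qed

text \<open>
  The first-order conditions in the direction \<open>e 2\<close>, which is tangent to the quadric along the line. The
  correction by \<open>e 4\<close> keeps the curve on the quadric.
\<close>
lemma second_direction: "n 0 2 0 = 0" "n 1 2 0 = 0" "n 0 2 1 = 0" "n 1 2 1 = 0"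
  "n 0 0 3 = 0"
proof -
  let ?x = "\<lambda>s. e 0 + s *s e 1"
  have q: "qI (?x s + t *s e 2 + t^2 *s ((-1/12) *s e 4)) = 0" for s t
    by (simp add: qI_def axis_def power2_eq_square)
  note T = tangent_fields[OF q]
  have R: "n 0 2 0 + (n 0 2 1 + n 1 2 0) * s + n 1 2 1 * s^2 = 0" for s
    using radial_polarized[of "?x s" "e 2"] vanishes_on_osculating_plane
    by (simp add: expand sym_basis) algebra
  have Y: "4 * n 0 2 0 + (3 * n 0 2 1 + 4 * n 1 2 0) * s + 3 * n 1 2 1 * s^2 = 0" for s
    using T(2)[of s] vanishes_on_osculating_plane
    by (simp add: expand sym_basis field_linear field_basis) algebra
  have X: "(4 * n 0 2 1 + n 0 0 3) + (4 * n 1 2 1 + 3 * n 0 2 2 + 2 * n 0 1 3) * s + (3 * n 1 2 2 + n 1 1 3) * s^2 = 0" for s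
    using T(1)[of s] vanishes_on_osculating_plane
    by (simp add: expand sym_basis field_linear field_basis) algebra
  note R' = quadratic_coefficients_zero[OF R]
  note Y' = quadratic_coefficients_zero[OF Y]
  note X' = quadratic_coefficients_zero[OF X]
  show "n 0 2 0 = 0" by (rule R')
  show "n 1 2 1 = 0" by (rule R')
  show b: "n 1 2 0 = 0" using R'(2) Y'(2) by algebra
  show c: "n 0 2 1 = 0" using R'(2) b by simp
  show "n 0 0 3 = 0" using X'(1) c by simp
qed

text \<open>
  The value \<open>n 0 2 3\<close> enters the exterior derivative along the line spanned by \<open>e 0\<close> and \<open>e 1\<close>, but the
  first-order conditions there do not determine it. It is related to \<open>n 0 3 2\<close> on the line spanned
  by \<open>e 0\<close> and \<open>e 3\<close>, which the quadric also contains.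
\<close>
lemma mixed_coefficients: "n 0 3 2 = - 3 * n 2 3 0" "n 0 2 3 = 2 * n 2 3 0"
proof -
  let ?x = "\<lambda>s. e 0 + s *s e 3"
  have q: "qI (?x s + t *s e 2 + t^2 *s ((-1/12) *s e 4)) = 0" for s t
    by (simp add: qI_def axis_def power2_eq_square)
  note T = tangent_fields[OF q]
  have 30: "W (e 3) (e 0) k = W (e 0) (e 3) k" for k by (rule sym)
  have R: "(2 * n 0 2 0 + n 0 0 2) + (2 * n 0 2 3 + 2 * n 2 3 0 + 2 * n 0 3 2) * s + (2 * n 2 3 3 + n 3 3 2) * s^2 = 0" for s
    using radial_polarized[of "?x s" "e 2"]
    by (simp add: expand sym_basis 30 algebra_simps power2_eq_square)
  have Y: "(8 * n 0 2 0 + 2 * n 0 0 2) + (2 * n 0 2 3 + 8 * n 2 3 0 + 4 * n 0 3 2) * s + (2 * n 2 3 3 + 2 * n 3 3 2) * s^2 = 0" for s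
    using T(2)[of s]
    by (simp add: expand sym_basis 30 field_linear field_basis) algebra
  note R' = quadratic_coefficients_zero(2)[OF R]
  note Y' = quadratic_coefficients_zero(2)[OF Y]
  show 1: "n 0 3 2 = - 3 * n 2 3 0" using R' Y' by algebra
  show "n 0 2 3 = 2 * n 2 3 0" using R' 1 by algebra
qed

text \<open>
  The tangent space of the quadric at \<open>e 0 + s *s e 1\<close> is spanned by \<open>e 0\<close>, \<open>e 1\<close>, \<open>e 2\<close> and
  \<open>4 *s e 3 + s *s e 4\<close>. These are the first-order conditions of the affine fields in the last of these directions,
  together with those of the radial field in the directions \<open>e 3\<close> and \<open>e 4\<close>, which hold off the quadric too.
\<close>
lemma transverse_direction:
  "n 0 3 0 = 0" "n 0 3 1 + n 1 3 0 + n 0 1 3 = 0" "2 * n 1 3 1 + n 1 1 3 = 0"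
  "2 * n 0 4 0 + n 0 0 4 = 0" "n 0 4 1 + n 1 4 0 + n 0 1 4 = 0" "2 * n 1 4 1 + n 1 1 4 = 0"
  "8 * n 0 4 0 + 32 * n 1 3 0 + 24 * n 0 3 1 + 8 * n 0 1 3 = 0"
  "8 * n 1 4 0 + 6 * n 0 4 1 + 24 * n 1 3 1 + 4 * n 1 1 3 = 0" "n 1 4 1 = 0"
  "32 * n 0 3 1 + 4 * n 0 0 4 = 0" 
  "8 * n 0 4 1 + 32 * n 1 3 1 + 24 * n 0 3 2 + 8 * n 0 1 4 = 0"
proof -
  let ?x = "\<lambda>s. e 0 + s *s e 1"
  have q: "qI (?x s + t *s (4 *s e 3 + s *s e 4) + t^2 *s 0) = 0" for s t
    by (simp add: qI_def axis_def power2_eq_square)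
  note T = tangent_fields[OF q]
  note z = vanishes_on_osculating_plane second_direction(5)
  have R3: "2 * n 0 3 0 + 2 * (n 0 3 1 + n 1 3 0 + n 0 1 3) * s + (2 * n 1 3 1 + n 1 1 3) * s^2 = 0" for s
    using radial_polarized[of "?x s" "e 3"] z
    by (simp add: expand sym_basis) algebra
  have R4: "(2 * n 0 4 0 + n 0 0 4) + 2 * (n 0 4 1 + n 1 4 0 + n 0 1 4) * s + (2 * n 1 4 1 + n 1 1 4) * s^2 = 0" for s
    using radial_polarized[of "?x s" "e 4"] z
    by (simp add: expand sym_basis) algebra
  have Y: "32 * n 0 3 0 + (8 * n 0 4 0 + 32 * n 1 3 0 + 24 * n 0 3 1 + 8 * n 0 1 3) * s 
     + (8 * n 1 4 0 + 6 * n 0 4 1 + 24 * n 1 3 1 + 4 * n 1 1 3) * s^2 + 6 * n 1 4 1 * s^3 = 0" for s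
    using T(2)[of s] z
    by (simp add: expand sym_basis field_linear field_basis) algebra
  have X: "(32 * n 0 3 1 + 4 * n 0 0 4) + (8 * n 0 4 1 + 32 * n 1 3 1 + 24 * n 0 3 2 + 8 * n 0 1 4) * s
     + (8 * n 1 4 1 + 6 * n 0 4 2 + 24 * n 1 3 2 + 4 * n 1 1 4) * s^2 + 6 * n 1 4 2 * s^3 = 0" for s
    using T(1)[of s] z
    by (simp add: expand sym_basis field_linear field_basis) algebra
  note R3' = quadratic_coefficients_zero[OF R3]
  note R4' = quadratic_coefficients_zero[OF R4]
  note Y' = cubic_coefficients_zero[OF Y]
  note X' = cubic_coefficients_zero[OF X]
  show "n 0 3 0 = 0" "2 * n 1 3 1 + n 1 1 3 = 0" using R3' by simp_all
  show "n 0 3 1 + n 1 3 0 + n 0 1 3 = 0" using R3'(2) by algebra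
  show "2 * n 0 4 0 + n 0 0 4 = 0" "2 * n 1 4 1 + n 1 1 4 = 0" using R4' by simp_all
  show "n 0 4 1 + n 1 4 0 + n 0 1 4 = 0" using R4'(2) by algebra
  show "8 * n 0 4 0 + 32 * n 1 3 0 + 24 * n 0 3 1 + 8 * n 0 1 3 = 0"
    "8 * n 1 4 0 + 6 * n 0 4 1 + 24 * n 1 3 1 + 4 * n 1 1 3 = 0" "n 1 4 1 = 0" using Y' by simp_all
  show "32 * n 0 3 1 + 4 * n 0 0 4 = 0" 
    "8 * n 0 4 1 + 32 * n 1 3 1 + 24 * n 0 3 2 + 8 * n 0 1 4 = 0" using X' by simp_all
qed

text \<open>
  The parameters \<open>n 0 1 3\<close>, \<open>n 1 1 3\<close> and \<open>n 0 4 1\<close> remain free. A two-dimensional part of this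
  freedom accounts for adding \<open>q \<alpha> - \<alpha>(x) dq / 2\<close> with \<open>\<alpha>\<close> in the span of the first two
  coordinates. The combination \<open>4 * n 1 1 3 - n 0 4 1\<close>, which is zero for
  these forms, measures the multiple of the affine foliation that is contained in the restriction to the quadric.
\<close>
lemma linear_solution:
  "n 1 1 4 = 0" "n 0 0 4 = - 8 * n 0 1 3" "n 0 3 1 = n 0 1 3" "n 1 3 0 = - 2 * n 0 1 3"
  "n 0 4 0 = 4 * n 0 1 3"
  "4 * n 0 1 4 = - 4 * n 1 1 3 - n 0 4 1" "4 * n 1 4 0 = 4 * n 1 1 3 - 3 * n 0 4 1"
  "4 * n 0 3 2 = 4 * n 1 1 3 - n 0 4 1"
  using transverse_direction by algebra+

text \<open>
  Integrability is used on the triples \<open>(e i, e 3, e 4)\<close>. As \<open>e 0\<close> and \<open>e 2\<close> are in the kernel of the form along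
  the line, only two of its three terms survive. If the multiple of the affine foliation were
  nonzero, the triple with \<open>i = 0\<close> would force \<open>n 0 1 3\<close> and \<open>n 1 1 3\<close> to vanish, and then the
  triple with \<open>i = 2\<close> would equate two coefficients that the linear conditions make different.
\<close>
lemma transverse_part_vanishes: "n 0 1 4 = - 2 * n 1 1 3"
proof (rule ccontr)
  assume "n 0 1 4 \<noteq> - 2 * n 1 1 3"
  let ?x = "\<lambda>s. e 0 + s *s e 1"
  note z = vanishes_on_osculating_plane second_direction(1-5) linear_solution(1-5) transverse_direction(1)
  have ne: "4 * n 1 1 3 - n 0 4 1 \<noteq> 0"
  proof
    assume "4 * n 1 1 3 - n 0 4 1 = 0"
    hence "4 * n 0 1 4 = 4 * (- 2 * n 1 1 3)" using linear_solution(6) by algebra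
    thus False using \<open>n 0 1 4 \<noteq> - 2 * n 1 1 3\<close> by simp
  qed
  have a3: "W (?x s) (?x s) (e 3) = 2 * n 0 1 3 * s + n 1 1 3 * s^2" for s
    using z by (simp add: expand sym_basis power2_eq_square algebra_simps)
  have a4: "W (?x s) (?x s) (e 4) = - 8 * n 0 1 3 + 2 * n 0 1 4 * s" for s
    using z by (simp add: expand sym_basis)
  have a: "W (?x s) (?x s) (e 0) = 0" "W (?x s) (?x s) (e 2) = 0" for s
    using z by (simp_all add: expand sym_basis)
  have I: "W (?x s) (?x s) (e 3) * (W (?x s) (e 4) (e i) - W (?x s) (e i) (e 4))
       + W (?x s) (?x s) (e 4) * (W (?x s) (e i) (e 3) - W (?x s) (e 3) (e i)) = 0"
     if "W (?x s) (?x s) (e i) = 0" for s i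
    using integrable[of "?x s" "e i" "e 3" "e 4"] that by simp
  have d: "W (?x s) (e 4) (e 0) - W (?x s) (e 0) (e 4) = 12 * n 0 1 3 + (n 1 4 0 - n 0 1 4) * s"
    "W (?x s) (e 0) (e 3) - W (?x s) (e 3) (e 0) = 3 * n 0 1 3 * s" for s
    using z by (simp_all add: expand sym_basis algebra_simps)
  have "0 + 0 * s + (2 * n 0 1 3 * (n 1 4 0 - n 0 1 4) + 12 * n 0 1 3 * n 1 1 3 + 6 * n 0 1 3 * n 0 1 4) * s^2
    + n 1 1 3 * (n 1 4 0 - n 0 1 4) * s^3 = 0" for s
    using I[OF a(1), of s, unfolded a3 a4 d] by algebra
  note J = cubic_coefficients_zero(3,4)[OF this]
  have "n 1 1 3 * (4 * n 1 1 3 - n 0 4 1) = 0"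
    using J(2) linear_solution(6,7) by algebra
  hence c2: "n 1 1 3 = 0" using ne by simp
  have "n 0 1 3 * (4 * n 1 1 3 - n 0 4 1) = 0"
    using J(1) linear_solution(6,7) by algebra
  hence c1: "n 0 1 3 = 0" using ne by simp
  have "0 + n 0 1 4 * (n 0 2 3 - n 0 3 2) * s + n 0 1 4 * (n 1 2 3 - n 1 3 2) * s^2 = 0" for s
    using I[OF a(2), of s, unfolded a3 a4 c1 c2] by (simp add: expand) algebra
  note K = quadratic_coefficients_zero(2)[OF this]
  have "n 0 4 1 * n 0 4 1 = 0" using K mixed_coefficients linear_solution(6,8) c2 by algebra
  thus False using ne c2 by simp
qed

text \<open>The hypothesis on \<open>v\<close> is tangency to the quadric at \<open>vec5 p s 0 0 0\<close>.\<close>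
lemma vanishes_on_tangent_line:
  assumes "p \<noteq> 0" "4 * p * v$4 = s * v$3"
  shows "W (vec5 p s 0 0 0) (vec5 p s 0 0 0) v = 0"
proof -
  define t where "t = s / p"
  have x: "vec5 p s 0 0 0 = p *s (e 0 + t *s e 1)"
    using assms(1) by (simp add: t_def vec_eq_iff forall_5 axis_def)
  have v: "v = v$0 *s e 0 + v$1 *s e 1 + v$2 *s e 2 + v$3 *s e 3 + v$4 *s e 4"
    by (simp add: vec_eq_iff forall_5 axis_def)
  have v4: "4 * v$4 = t * v$3" using assms by (simp add: t_def field_simps)
  note z = vanishes_on_osculating_plane second_direction(1-5) linear_solution(1-5) transverse_part_vanishes
  have "W (e 0 + t *s e 1) (e 0 + t *s e 1) v = 0"
    by (subst v) (use z v4 in \<open>simp add: expand sym_basis\<close>, algebra)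
  thus ?thesis by (simp only: x scale_left scale_right) simp
qed

end

text \<open>
  Translations preserve the quadric, the radial field and the span of the affine fields, and
  integrability is natural under pullback. This transports what was shown on one tangent line of the
  rational normal curve to the tangent lines at all fourth powers of \<open>x + c y\<close>.
\<close>
lemma (in affine_invariant_quadratic_form) pullback:
  "affine_invariant_quadratic_form (\<lambda>x y v. W (translate c x) (translate c y) (translate c v))"
  using radial integrable translation scaling
  by unfold_locales (simp_all add: translate_linear translate_fields expand qI_translate, rule sym)

lemma (in affine_invariant_quadratic_form) vanishes_on_swept_locus:
  assumes "p \<noteq> 0" and "cdot v (BI *v translate c (vec5 p s 0 0 0)) = 0"
  shows "W (translate c (vec5 p s 0 0 0)) (translate c (vec5 p s 0 0 0)) v = 0"
proof -
  interpret pulled: affine_invariant_quadratic_form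
    "\<lambda>x y v. W (translate c x) (translate c y) (translate c v)" by (rule pullback)
  define u where "u = translate (- c) v"
  have v: "v = translate c u" by (simp add: u_def translate_inverse)
  have "4 * p * u$4 = s * u$3" using assms(2) unfolding v polar_translate unfolding polar_BI by simp algebra
  thus ?thesis unfolding v by (rule pulled.vanishes_on_tangent_line[OF assms(1)])
qed

section \<open>The surface of quartics with a triple root\<close>

text \<open>
  The parametrization of the quartics \<open>(x + c y)\<^sup>3 (p x + (c p + s) y)\<close> by \<open>p\<close>, \<open>s\<close>, \<open>c\<close> is an immersion
  where \<open>s\<close> is nonzero; for \<open>s = 0\<close> the fourth root coincides with the triple one. The cone over this
  surface has dimension three.
\<close>
lemma contains_swept_locus:
  assumes "\<And>p s c. p \<noteq> 0 \<Longrightarrow> s \<noteq> 0 \<Longrightarrow> translate c (vec5 p s 0 0 0) \<in> Z"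
  shows "contains_submanifold TYPE(3) Z"
proof -
  define U :: "(complex^3) set" where "U = {u. u$1 \<noteq> 0} \<inter> {u. u$2 \<noteq> 0}"
  define \<phi> :: "complex^3 \<Rightarrow> complex^5" where "\<phi> u = translate (u$3) (vec5 (u$1) (u$2) 0 0 0)" for u
  define \<phi>' where "\<phi>' u h = (let p = u$1; s = u$2; c = u$3; dp = h$1; ds = h$2; dc = h$3 in
     vec5 dp (4 * (c * dp + p * dc) + ds) (6 * (c^2 * dp + 2 * c * p * dc) + 3 * (c * ds + s * dc))
       (4 * (c^3 * dp + 3 * c^2 * p * dc) + 3 * (c^2 * ds + 2 * c * s * dc))
       (c^4 * dp + 4 * c^3 * p * dc + c^3 * ds + 3 * c^2 * s * dc))" for u h :: "complex^3"
  have [derivative_intros]: "((\<lambda>u. u $ i) has_derivative (\<lambda>h. h $ i)) (at u)" for u :: "complex^3" and i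
    by (rule bounded_linear_imp_has_derivative[OF bounded_linear_vec_nth])
  have deriv: "(\<phi> has_derivative \<phi>' u) (at u)" for u
  proof (rule has_derivative_vec)
    fix i :: 5
    show "((\<lambda>u. \<phi> u $ i) has_derivative (\<lambda>h. \<phi>' u h $ i)) (at u)"
      using exhaust_5[of i]
      by (auto simp: \<phi>_def translate_def subst4_def \<phi>'_def Let_def fun_eq_iff algebra_simps
          intro!: derivative_eq_intros)
  qed
  have "open U" unfolding U_def by (intro open_Int open_Collect_neq continuous_intros)
  moreover have "U \<noteq> {}" using vec_lambda_beta[of "\<lambda>i. 1"] unfolding U_def by (intro ex_in_conv[THEN iffD1] exI[of _ "\<chi> i. 1"]) simp
  moreover have "holomorphic_map_on U \<phi>"
    unfolding holomorphic_map_on_def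
  proof
    fix u
    have "\<forall>c v. \<phi>' u (c *s v) = c *s \<phi>' u v"
      by (simp add: \<phi>'_def Let_def vec_eq_iff forall_5 algebra_simps)
    thus "\<exists>f'. (\<phi> has_derivative f') (at u) \<and> (\<forall>c v. f' (c *s v) = c *s f' v)" using deriv by blast
  qed
  moreover have "inj (frechet_derivative \<phi> (at u))" if "u \<in> U" for u
  proof -
    have "h = 0" if h: "\<phi>' u h = 0" for h
    proof -
      have 1: "h$1 = 0" using h by (simp add: \<phi>'_def Let_def vec_eq_iff forall_5)
      have 2: "4 * (u$1 * h$3) + h$2 = 0" "12 * (u$3 * (u$1 * h$3)) + 3 * (u$3 * h$2 + u$2 * h$3) = 0"
        using h 1 by (simp_all add: \<phi>'_def Let_def vec_eq_iff forall_5)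
      have "u$2 * h$3 = 0" using 2 by algebra
      hence "h$3 = 0" using \<open>u \<in> U\<close> by (simp add: U_def)
      thus ?thesis using 1 2(1) by (simp add: vec_eq_iff forall_3)
    qed
    thus ?thesis
      using linear_injective_0[OF has_derivative_linear[OF deriv]] frechet_derivative_at[OF deriv] by metis
  qed
  moreover have "\<phi> ` U \<subseteq> Z" using assms by (auto simp: \<phi>_def U_def)
  ultimately show ?thesis unfolding contains_submanifold_def by blast
qed

section \<open>The foliation does not extend\<close>

lemma power_int_two_inject:
  assumes "(2::complex) powi m = 2 powi n" shows "m = n"
proof -
  have "(2::real) powi m = 2 powi n" using arg_cong[OF assms, of norm] by (simp add: norm_power_int)
  thus ?thesis using power_int_strict_increasing[of m n "2::real"] power_int_strict_increasing[of n m "2::real"]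
    by (cases m n rule: linorder_cases) auto
qed

text \<open>
  The fields \<open>translation_field\<close> and \<open>scaling_field\<close> generate the affine action, so the two hypotheses
  on them say that the restriction of \<open>\<omega>\<close> to the quadric is tangent to the affine orbits.
\<close>
lemma foliation_defines_quadratic_form:
  assumes fol: "foliation_on_P4 1 \<omega>"
    and X: "\<And>x. x \<noteq> 0 \<Longrightarrow> qI x = 0 \<Longrightarrow> \<omega> x (translation_field x) = 0"
    and Y: "\<And>x. x \<noteq> 0 \<Longrightarrow> qI x = 0 \<Longrightarrow> \<omega> x (scaling_field x) = 0"
  obtains W where "affine_invariant_quadratic_form W" "\<forall>x v. x \<noteq> 0 \<longrightarrow> W x x v = 2 * \<omega> x v"
proof -
  have tw: "twisted_one_form (UNIV - {0}) (\<lambda>x. UNIV) 3 \<omega>" 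
    and int: "integrable_one_form (UNIV - {0}) (\<lambda>x. UNIV) \<omega>"
    using fol by (simp_all add: foliation_on_P4_def codim_one_foliation_def)
  let ?A = "coefficients \<omega>"
  note A = quadratic_form_on_P4[OF tw]
  define W where "W x y v = cdot (?A (x + y) - ?A x - ?A y) v" for x y v
  have A0: "?A 0 = 0" by (simp add: coefficients_def)
  have W_deriv: "W x y v = cdot (frechet_derivative ?A (at x) y) v" if "x \<noteq> 0" for x y v
    by (simp add: W_def A(3)[OF that])
  have W_zero: "W 0 y v = 0" for y v by (simp add: W_def A0 cdot_def)
  have sym: "W x y v = W y x v" for x y v by (simp add: W_def add.commute diff_diff_eq)
  have square: "W x x v = 2 * \<omega> x v" if "x \<noteq> 0" for x v
  proof -
    have "x + x = 2 *s x" by (simp add: vec_eq_iff)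
    hence "?A (x + x) = 4 *s ?A x" using A(2)[of 2 x] by simp
    hence "W x x v = cdot (2 *s ?A x) v" unfolding W_def by (intro arg_cong2[where f = cdot]) (simp_all add: vec_eq_iff)
    thus ?thesis by (simp add: cdot_scale A(1)[OF that])
  qed
  have "affine_invariant_quadratic_form W"
  proof
    show "W x y v = W y x v" for x y v by (rule sym)
    show "W (x + y) z v = W x z v + W y z v" for x y z v
      unfolding sym[of _ z] by (cases "z = 0") (simp_all add: W_zero W_deriv A(4) cdot_add)
    show "W (c *s x) z v = c * W x z v" for c x z v
      unfolding sym[of _ z] by (cases "z = 0") (simp_all add: W_zero W_deriv A(5) cdot_scale)
    show "W x y (u + v) = W x y u + W x y v" for x y u v by (simp add: W_def cdot_add)
    show "W x y (c *s v) = c * W x y v" for x y c v by (simp add: W_def cdot_scale)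
    show "W x x x = 0" for x
      using tw by (cases "x = 0") (simp_all add: W_zero square twisted_one_form_def)
    show "W x x (translation_field x) = 0" if "qI x = 0" for x
      using X that by (cases "x = 0") (simp_all add: W_zero square)
    show "W x x (scaling_field x) = 0" if "qI x = 0" for x
      using Y that by (cases "x = 0") (simp_all add: W_zero square)
    show "W x x u * (W x v w - W x w v) + W x x v * (W x w u - W x u w) + W x x w * (W x u v - W x v u) = 0"
      for x u v w
    proof (cases "x = 0")
      case False
      have integrable: "\<omega> x u * ext_deriv ?A x v w + \<omega> x v * ext_deriv ?A x w u + \<omega> x w * ext_deriv ?A x u v = 0"
        using int twisted_form_on_P4[OF tw] False by (simp add: integrable_one_form_def)
      have "ext_deriv ?A x a b = W x a b - W x b a" for a b
        by (simp add: ext_deriv_def W_deriv[OF False])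
      hence "\<omega> x u * (W x v w - W x w v) + \<omega> x v * (W x w u - W x u w) + \<omega> x w * (W x u v - W x v u) = 0"
        using integrable by simp
      thus ?thesis unfolding square[OF False] by algebra
    qed (simp add: W_zero)
  qed
  thus ?thesis using that square by blast
qed

theorem theorem4p4:
  fixes r :: "4 \<Rightarrow> complex^2" and B :: "complex^5^5" and \<A> :: "complex^5 \<Rightarrow> complex^5 \<Rightarrow> complex"
  assumes "\<forall>j. r j \<noteq> 0"
    and "smooth_quadric B"
    and "orbit_closure (quartic_with_roots r) = quadric B"
    and "foliation_on_quadric B 1 \<A>"
    and "induced_by_affine_group B \<A>"
  shows "\<not> extends_to_P4 B \<A>"
proof
  assume "extends_to_P4 B \<A>"
  then obtain deg \<omega> where fol: "foliation_on_P4 deg \<omega>" and transverse: "transverse_to_quadric B \<omega>"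
    and "same_foliation (quadric B) (quadric_tangent B) \<omega> \<A>"
    by (auto simp: extends_to_P4_def)
  then obtain k where k: "\<And>x v. x \<in> quadric B \<Longrightarrow> v \<in> quadric_tangent B x \<Longrightarrow> \<omega> x v = k * \<A> x v"
    by (auto simp: same_foliation_def)
  have inv: "subst4 h x \<in> quadric B" if "invertible h" "x \<in> quadric B" for h x
    using orbit_closure_invariant[of h x "quartic_with_roots r"] assms(3) that by simp
  obtain c where c: "c \<noteq> 0" "\<And>i j. B $ i $ j = c * BI $ i $ j"
    by (rule invariant_quadric[OF assms(2) inv]) blast+
  have polar: "cdot x (B *v y) = c * cdot x (BI *v y)" for x y
    by (simp add: cdot_def matrix_vector_mult_def c(2) sum_distrib_left mult_ac)
  have Q: "x \<in> quadric B \<longleftrightarrow> x \<noteq> 0 \<and> qI x = 0" for x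
    using c(1) by (simp add: quadric_def polar cdot_BI)
  have T: "v \<in> quadric_tangent B x \<longleftrightarrow> cdot v (BI *v x) = 0" for x v
    using c(1) by (simp add: quadric_tangent_def polar)
  have swept: "translate a (vec5 p s 0 0 0) \<in> quadric B" if "p \<noteq> 0" for a p s
  proof -
    have "translate a (vec5 p s 0 0 0) $ 0 = p" by (simp add: translate_def subst4_def)
    thus ?thesis using that unfolding Q by (auto simp: qI_translate) (simp add: qI_def)
  qed
  have homogeneous: "\<omega> (2 *s x) (2 *s v) = 2 powi (deg + 2) * \<omega> x v" if "x \<noteq> 0" for x v
    using fol that by (simp add: foliation_on_P4_def codim_one_foliation_def twisted_one_form_def)
  have homogeneous': "\<A> (2 *s x) (2 *s v) = 2 powi 3 * \<A> x v" if "x \<in> quadric B" "v \<in> quadric_tangent B x" for x v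
    using assms(4) that by (simp add: foliation_on_quadric_def codim_one_foliation_def twisted_one_form_def)
  \<comment> \<open>Transversality is used twice: to see that \<open>\<omega>\<close> is not identically zero on the quadric, which pins
    down its degree, and for the final contradiction.\<close>
  have not_zero_set: "\<not> contains_submanifold TYPE(3) (zero_set (quadric B) (quadric_tangent B) \<omega>)"
    using transverse by (simp add: transverse_to_quadric_def)
  have "\<exists>x v. x \<in> quadric B \<and> v \<in> quadric_tangent B x \<and> \<omega> x v \<noteq> 0"
  proof (rule ccontr)
    assume "\<not> ?thesis"
    hence "quadric B \<subseteq> zero_set (quadric B) (quadric_tangent B) \<omega>"
      by (auto simp: zero_set_def)
    hence "contains_submanifold TYPE(3) (zero_set (quadric B) (quadric_tangent B) \<omega>)"
      by (intro contains_swept_locus subsetD[OF _ swept])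
    thus False using not_zero_set by contradiction
  qed
  then obtain x v where x: "x \<in> quadric B" "v \<in> quadric_tangent B x" "\<omega> x v \<noteq> 0" by blast
  have deg: "deg = 1"
  proof -
    have "2 *s x \<in> quadric B" "2 *s v \<in> quadric_tangent B (2 *s x)"
      using x by (simp_all add: Q T cdot_scale vector_scalar_commute flip: cdot_BI)
    hence "\<omega> (2 *s x) (2 *s v) = 2 powi 3 * \<omega> x v"
      using k homogeneous' x by simp
    hence "(2::complex) powi (deg + 2) = 2 powi 3" using homogeneous[of x v] x by (simp add: Q)
    hence "deg + 2 = 3" by (rule power_int_two_inject)
    thus ?thesis by simp
  qed
  have leaf: "\<omega> x v = 0" if "x \<in> quadric B" "v \<in> affine_orbit_tangent x" "cdot v (BI *v x) = 0" for x v
    using k[of x v] assms(5) that by (simp add: induced_by_affine_group_def T)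
  have translation: "\<omega> x (translation_field x) = 0" if "x \<noteq> 0" "qI x = 0" for x
  proof (rule leaf)
    show "cdot (translation_field x) (BI *v x) = 0"
      unfolding polar_BI by (simp add: translation_field_def field_simps)
  qed (use that translation_field_tangent in \<open>auto simp: Q\<close>)
  have scaling: "\<omega> x (scaling_field x) = 0" if "x \<noteq> 0" "qI x = 0" for x
  proof (rule leaf)
    have "cdot (scaling_field x) (BI *v x) = 2 * qI x"
      unfolding polar_BI by (simp add: scaling_field_def qI_def power2_eq_square)
    thus "cdot (scaling_field x) (BI *v x) = 0" using that by simp
  qed (use that scaling_field_tangent in \<open>auto simp: Q\<close>)
  obtain W where W: "affine_invariant_quadratic_form W" "\<forall>x v. x \<noteq> 0 \<longrightarrow> W x x v = 2 * \<omega> x v"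
    by (rule foliation_defines_quadratic_form[OF fol[unfolded deg] translation scaling]) blast+
  have zeros: "translate a (vec5 p s 0 0 0) \<in> zero_set (quadric B) (quadric_tangent B) \<omega>" if "p \<noteq> 0" for a p s
  proof -
    let ?y = "translate a (vec5 p s 0 0 0)"
    have "2 * \<omega> ?y v = 0" if "v \<in> quadric_tangent B ?y" for v
      using affine_invariant_quadratic_form.vanishes_on_swept_locus[OF W(1) \<open>p \<noteq> 0\<close>, of v a s] W(2)
        that swept[OF \<open>p \<noteq> 0\<close>] by (simp add: T Q)
    thus ?thesis using swept[OF that] by (simp add: zero_set_def)
  qed
  have "contains_submanifold TYPE(3) (zero_set (quadric B) (quadric_tangent B) \<omega>)"
    by (rule contains_swept_locus) (rule zeros)
  thus False using not_zero_set by contradiction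
qed

end
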